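(* Let $(M^n,g)$ be a compact Riemannian manifold with $n>2$, let $X$ be a conformal vector field on $M$, and let $q$ be a symmetric $(0,2)$-tensor field on $M$ such that $\mathrm{div}\,q=\frac12\nabla\,\mathrm{tr}(q)$. Then $$\int_M\big(\mathcal{L}_X\mathrm{tr}(q)\big)\,dvol_g=0 .$$
   Context: All objects are smooth; compact means compact without boundary. $\mathrm{tr}$ is the trace with respect to $g$ and $(\mathrm{div}\,q)_j=\nabla^iq_{ij}$ (identified with a vector field via $g$, so the condition reads $\nabla^iq_{ij}=\frac12\nabla_j\mathrm{tr}(q)$). $X$ is a conformal vector field if $\mathcal{L}_Xg=2\sigma g$ for some function $\sigma$ on $M$. $\mathcal{L}_X\mathrm{tr}(q)=X(\mathrm{tr}(q))$ is the Lie derivative of a function. *)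

theory Defs
  imports "HOL-Analysis.Analysis"
begin

(* Smooth manifolds, tensor fields and Riemannian volume in terms of charts. A chart is a pair of
   its domain and its coordinate map; the coordinate map is arbitrary outside the domain. The
   coordinate indices range over a finite ordered type 'n, so the dimension is CARD('n). *)

type_synonym ('a, 'n) chart = "'a set \<times> ('a \<Rightarrow> real ^ 'n)"

abbreviation cdom :: "('a, 'n) chart \<Rightarrow> 'a set" where "cdom \<equiv> fst"
abbreviation cmap :: "('a, 'n) chart \<Rightarrow> 'a \<Rightarrow> real ^ 'n" where "cmap \<equiv> snd"

definition crange :: "('a, 'n) chart \<Rightarrow> (real ^ 'n) set" where
  "crange c = cmap c ` cdom c"

definition cinv :: "('a, 'n) chart \<Rightarrow> real ^ 'n \<Rightarrow> 'a" where
  "cinv c = inv_into (cdom c) (cmap c)"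

(* Used on open sets S only, where this is the usual notion of a C^k map. *)
primrec Ck_on :: "nat \<Rightarrow> 'a::real_normed_vector set \<Rightarrow> ('a \<Rightarrow> 'b::real_normed_vector) \<Rightarrow> bool" where
  "Ck_on 0 S f \<longleftrightarrow> continuous_on S f"
| "Ck_on (Suc k) S f \<longleftrightarrow>
     (\<forall>x\<in>S. f differentiable (at x)) \<and> (\<forall>v. Ck_on k S (\<lambda>x. frechet_derivative f (at x) v))"

definition smooth_on :: "'a::real_normed_vector set \<Rightarrow> ('a \<Rightarrow> 'b::real_normed_vector) \<Rightarrow> bool" where
  "smooth_on S f \<longleftrightarrow> (\<forall>k. Ck_on k S f)"

(* The atlas A need not be maximal. Neither connectedness nor orientability is required. *)
locale smooth_manifold =
  fixes T :: "'a topology" and A :: "('a, 'n::{finite, wellorder}) chart set"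
  assumes Hausdorff: "Hausdorff_space T"
    and second_countable: "second_countable T"
    and covers: "(\<Union>c\<in>A. cdom c) = topspace T"
    and open_dom: "c \<in> A \<Longrightarrow> openin T (cdom c)"
    and open_range: "c \<in> A \<Longrightarrow> open (crange c)"
    and homeo: "c \<in> A \<Longrightarrow>
      homeomorphic_map (subtopology T (cdom c)) (top_of_set (crange c)) (cmap c)"
    and compatible: "c \<in> A \<Longrightarrow> d \<in> A \<Longrightarrow>
      smooth_on (cmap c ` (cdom c \<inter> cdom d)) (cmap d \<circ> cinv c)"

definition smooth_fun :: "('a, 'n::finite) chart set \<Rightarrow> ('a \<Rightarrow> real) \<Rightarrow> bool" where
  "smooth_fun A f \<longleftrightarrow> (\<forall>c\<in>A. smooth_on (crange c) (f \<circ> cinv c))"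

(* A field assigns to a chart c and a point p of its domain the components at p with respect to
   the coordinates of c; these transform by the usual tensor laws under a change of chart.
   Entry (i, j) of transition c d p is the derivative of the i-th d-coordinate with respect to
   the j-th c-coordinate. *)
type_synonym ('a, 'n) vfield = "('a, 'n) chart \<Rightarrow> 'a \<Rightarrow> real ^ 'n"
type_synonym ('a, 'n) tensor02 = "('a, 'n) chart \<Rightarrow> 'a \<Rightarrow> real ^ 'n ^ 'n"

definition transition :: "('a, 'n::finite) chart \<Rightarrow> ('a, 'n) chart \<Rightarrow> 'a \<Rightarrow> real ^ 'n ^ 'n" where
  "transition c d p = jacobian (cmap d \<circ> cinv c) (at (cmap c p))"

definition vector_field :: "('a, 'n::finite) chart set \<Rightarrow> ('a, 'n) vfield \<Rightarrow> bool" where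
  "vector_field A X \<longleftrightarrow>
     (\<forall>c\<in>A. smooth_on (crange c) (X c \<circ> cinv c)) \<and>
     (\<forall>c\<in>A. \<forall>d\<in>A. \<forall>p\<in>cdom c \<inter> cdom d. X d p = transition c d p *v X c p)"

definition tensor_field02 :: "('a, 'n::finite) chart set \<Rightarrow> ('a, 'n) tensor02 \<Rightarrow> bool" where
  "tensor_field02 A q \<longleftrightarrow>
     (\<forall>c\<in>A. smooth_on (crange c) (q c \<circ> cinv c)) \<and>
     (\<forall>c\<in>A. \<forall>d\<in>A. \<forall>p\<in>cdom c \<inter> cdom d.
        q c p = transpose (transition c d p) ** q d p ** transition c d p)"

definition symmetric_tensor_field02 :: "('a, 'n::finite) chart set \<Rightarrow> ('a, 'n) tensor02 \<Rightarrow> bool" where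
  "symmetric_tensor_field02 A q \<longleftrightarrow>
     tensor_field02 A q \<and> (\<forall>c\<in>A. \<forall>p\<in>cdom c. transpose (q c p) = q c p)"

locale riemannian_manifold = smooth_manifold T A
  for T :: "'a topology" and A :: "('a, 'n::{finite, wellorder}) chart set" +
  fixes g :: "('a, 'n) tensor02"
  assumes metric_tensor: "symmetric_tensor_field02 A g"
    and metric_pos: "c \<in> A \<Longrightarrow> p \<in> cdom c \<Longrightarrow> v \<noteq> 0 \<Longrightarrow> v \<bullet> (g c p *v v) > 0"

(* partial c i f p is the derivative at p of f with respect to the i-th coordinate of c *)
definition "partial" :: "('a, 'n::finite) chart \<Rightarrow> 'n \<Rightarrow> ('a \<Rightarrow> real) \<Rightarrow> 'a \<Rightarrow> real" where
  "partial c i f p = frechet_derivative (f \<circ> cinv c) (at (cmap c p)) (axis i 1)"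

definition differential :: "('a \<Rightarrow> real) \<Rightarrow> ('a, 'n::finite) chart \<Rightarrow> 'a \<Rightarrow> real ^ 'n" where
  "differential f c p = (\<chi> j. partial c j f p)"

(* Scalars given by an invariant coordinate expression are evaluated in some chart around p. *)
definition chart_at :: "('a, 'n) chart set \<Rightarrow> 'a \<Rightarrow> ('a, 'n) chart" where
  "chart_at A p = (SOME c. c \<in> A \<and> p \<in> cdom c)"

definition lie_fun :: "('a, 'n::finite) chart set \<Rightarrow> ('a, 'n) vfield \<Rightarrow> ('a \<Rightarrow> real) \<Rightarrow> 'a \<Rightarrow> real" where
  "lie_fun A X f p = (let c = chart_at A p in \<Sum>k\<in>UNIV. X c p $ k * partial c k f p)"

definition lie_tensor02 :: "('a, 'n::finite) vfield \<Rightarrow> ('a, 'n) tensor02 \<Rightarrow> ('a, 'n) tensor02" where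
  "lie_tensor02 X q c p = (\<chi> i j. \<Sum>k\<in>UNIV.
      X c p $ k * partial c k (\<lambda>x. q c x $ i $ j) p
    + q c p $ k $ j * partial c i (\<lambda>x. X c x $ k) p
    + q c p $ i $ k * partial c j (\<lambda>x. X c x $ k) p)"

definition conformal_vector_field ::
  "('a, 'n::finite) chart set \<Rightarrow> ('a, 'n) tensor02 \<Rightarrow> ('a, 'n) vfield \<Rightarrow> bool" where
  "conformal_vector_field A g X \<longleftrightarrow> vector_field A X \<and>
     (\<exists>\<sigma>. smooth_fun A \<sigma> \<and>
        (\<forall>c\<in>A. \<forall>p\<in>cdom c. lie_tensor02 X g c p = (2 * \<sigma> p) *\<^sub>R g c p))"

definition metric_trace ::
  "('a, 'n::finite) chart set \<Rightarrow> ('a, 'n) tensor02 \<Rightarrow> ('a, 'n) tensor02 \<Rightarrow> 'a \<Rightarrow> real" where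
  "metric_trace A g q p = (let c = chart_at A p in
     \<Sum>i\<in>UNIV. \<Sum>j\<in>UNIV. matrix_inv (g c p) $ i $ j * q c p $ i $ j)"

(* The Christoffel symbol with upper index l and lower indices k, i. *)
definition christoffel ::
  "('a, 'n::finite) tensor02 \<Rightarrow> ('a, 'n) chart \<Rightarrow> 'a \<Rightarrow> 'n \<Rightarrow> 'n \<Rightarrow> 'n \<Rightarrow> real" where
  "christoffel g c p l k i = (1/2) * (\<Sum>m\<in>UNIV. matrix_inv (g c p) $ l $ m *
     (partial c k (\<lambda>x. g c x $ i $ m) p + partial c i (\<lambda>x. g c x $ k $ m) p
      - partial c m (\<lambda>x. g c x $ k $ i) p))"

(* cov_deriv g q c p k i j is the component \<nabla>_k q_ij for the Levi-Civita connection. *)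
definition cov_deriv ::
  "('a, 'n::finite) tensor02 \<Rightarrow> ('a, 'n) tensor02 \<Rightarrow> ('a, 'n) chart \<Rightarrow> 'a \<Rightarrow> 'n \<Rightarrow> 'n \<Rightarrow> 'n \<Rightarrow> real" where
  "cov_deriv g q c p k i j = partial c k (\<lambda>x. q c x $ i $ j) p
     - (\<Sum>l\<in>UNIV. christoffel g c p l k i * q c p $ l $ j)
     - (\<Sum>l\<in>UNIV. christoffel g c p l k j * q c p $ i $ l)"

definition divergence ::
  "('a, 'n::finite) tensor02 \<Rightarrow> ('a, 'n) tensor02 \<Rightarrow> ('a, 'n) chart \<Rightarrow> 'a \<Rightarrow> real ^ 'n" where
  "divergence g q c p = (\<chi> j. \<Sum>i\<in>UNIV. \<Sum>k\<in>UNIV. matrix_inv (g c p) $ i $ k * cov_deriv g q c p k i j)"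

(* The Borel measure whose density in every chart is the square root of det g with respect to
   Lebesgue measure. The Riemannian volume measure is the unique such measure. *)
definition is_volume_measure ::
  "'a topology \<Rightarrow> ('a, 'n::{finite, wellorder}) chart set \<Rightarrow> ('a, 'n) tensor02 \<Rightarrow> 'a measure \<Rightarrow> bool" where
  "is_volume_measure T A g \<mu> \<longleftrightarrow>
     space \<mu> = topspace T \<and>
     sets \<mu> = sigma_sets (topspace T) {U. openin T U} \<and>
     (\<forall>c\<in>A. \<forall>B\<in>sets \<mu>. B \<subseteq> cdom c \<longrightarrow>
        emeasure \<mu> B = (\<integral>\<^sup>+ x. ennreal (sqrt (det (g c (cinv c x)))) * indicator (cmap c ` B) x \<partial>lborel))"

definition riemannian_volume ::
  "'a topology \<Rightarrow> ('a, 'n::{finite, wellorder}) chart set \<Rightarrow> ('a, 'n) tensor02 \<Rightarrow> 'a measure" where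
  "riemannian_volume T A g = (THE \<mu>. is_volume_measure T A g \<mu>)"

end

theory Submission
  imports Defs
begin

text \<open>
  Write n for the dimension, t for the trace of q and \<sigma> for the conformal factor of X, so that
  \<nabla>_i X_j + \<nabla>_j X_i = 2 \<sigma> g_ij. The vector field Y with Y^i = q^i_j X^j satisfies
  div Y = (div q)(X) + q^ij \<nabla>_i X_j = X(t)/2 + \<sigma> t: the first term is the hypothesis on div q, and
  in the second one the symmetry of q replaces \<nabla>_i X_j by its symmetric part \<sigma> g_ij. On the other
  hand div X = n \<sigma>, hence div (t X) = X(t) + n \<sigma> t. The unknown factor \<sigma> therefore cancels in the
  field W = n Y - t X, and

    div W = (n/2 - 1) X(t).

  The integral of a divergence over a compact manifold is zero, and n/2 - 1 is nonzero for n > 2.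

  Two things are behind this. The pointwise computation is done in the coordinates of a single chart,
  where div W times the square root of det g is the sum of the \<partial>_i (sqrt (det g) W^i); the lemmas
  \<open>divergence_conformal\<close> and \<open>divergence_tensor_applied\<close> are the two formulas above as
  identities between finite sums of real numbers, and \<open>conformal_identity\<close> combines them.

  The analytic part is the lemma \<open>divergence_theorem\<close>. A partition of unity of class C^1 reduces it to
  fields with compact support in one chart, where it says that a partial derivative of a compactly
  supported function on Euclidean space has integral zero. This last fact follows from the
  translation invariance of Lebesgue measure by differentiating under the integral sign. The
  Riemannian volume is defined by a unique description, so its existence and uniqueness
  (\<open>volume_measure\<close>) have to be shown as well; existence rests on the change of variables formula.
  The calculus is that of functions of class C^1, which makes bump functions and quotients elementary.
\<close>

section \<open>Functions of class C^1 on Euclidean space\<close>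

text \<open>Taken from the Frechet derivative, as the coordinate derivatives of tensor fields are
  (\<open>partial_eq_pd\<close>). Restricting to scalar functions of the coordinates keeps the product and
  chain rules simple.\<close>

definition pd :: "'n \<Rightarrow> (real ^ 'n \<Rightarrow> real) \<Rightarrow> real ^ 'n::finite \<Rightarrow> real" where
  "pd i f x = frechet_derivative f (at x) (axis i 1)"

text \<open>Continuity of the partial derivatives alone would not give the chain rule at once, so
  Frechet differentiability is part of the definition. On an open set the two are equivalent.\<close>

definition C1_on :: "(real ^ 'n::finite) set \<Rightarrow> (real ^ 'n \<Rightarrow> real) \<Rightarrow> bool" where
  "C1_on U f \<longleftrightarrow> (\<forall>x\<in>U. f differentiable (at x)) \<and> (\<forall>i. continuous_on U (pd i f))"

lemma pd_eq: "(f has_derivative f') (at x) \<Longrightarrow> pd i f x = f' (axis i 1)"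
  by (metis frechet_derivative_at pd_def)

lemma partial_eq_pd: "partial c i f p = pd i (f \<circ> cinv c) (cmap c p)"
  by (simp add: partial_def pd_def)

lemma has_derivative_pd:
  fixes f :: "real ^ 'n::finite \<Rightarrow> real"
  assumes "f differentiable (at x)"
  shows "(f has_derivative (\<lambda>h. \<Sum>i\<in>UNIV. h $ i * pd i f x)) (at x)"
proof -
  let ?f' = "frechet_derivative f (at x)"
  have d: "(f has_derivative ?f') (at x)" using assms frechet_derivative_works by blast
  have lin: "linear ?f'" using assms by (rule linear_frechet_derivative)
  have "?f' h = (\<Sum>i\<in>UNIV. h $ i * pd i f x)" for h
  proof -
    have "?f' h = ?f' (\<Sum>i\<in>UNIV. h $ i *\<^sub>R axis i 1)"
      by (simp add: basis_expansion flip: scalar_mult_eq_scaleR)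
    also have "\<dots> = (\<Sum>i\<in>UNIV. h $ i * ?f' (axis i 1))"
      by (simp add: linear_sum[OF lin] linear_cmul[OF lin])
    finally show ?thesis by (simp add: pd_def)
  qed
  then have "?f' = (\<lambda>h. \<Sum>i\<in>UNIV. h $ i * pd i f x)" by blast
  with d show ?thesis by simp
qed

text \<open>Differentiation is local. This is how every identity below that holds only inside a chart
  or an overlap of charts is differentiated.\<close>

lemma derivative_local:
  assumes "open U" "x \<in> U" "\<And>y. y \<in> U \<Longrightarrow> f y = g y" 
  shows "f differentiable (at x) \<longleftrightarrow> g differentiable (at x)"
    and "pd i f x = pd i g x"
proof -
  have *: "(f has_derivative D) (at x) \<longleftrightarrow> (g has_derivative D) (at x)" for D
    using assms has_derivative_transform_within_open by metis
  then show "f differentiable (at x) \<longleftrightarrow> g differentiable (at x)" by (simp add: differentiable_def)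
  show "pd i f x = pd i g x" unfolding pd_def frechet_derivative_def by (simp add: *)
qed

lemma C1_on_imp_continuous_on: "C1_on U f \<Longrightarrow> continuous_on U f"
  unfolding C1_on_def
  by (meson differentiable_imp_continuous_within continuous_at_imp_continuous_on)

lemma C1_on_differentiable: "C1_on U f \<Longrightarrow> x \<in> U \<Longrightarrow> f differentiable (at x)"
  by (simp add: C1_on_def)

lemma C1_on_continuous_pd: "C1_on U f \<Longrightarrow> continuous_on U (pd i f)"
  by (simp add: C1_on_def)

lemma C1_on_cong:
  assumes "open U" "\<And>x. x \<in> U \<Longrightarrow> f x = g x"
  shows "C1_on U f \<longleftrightarrow> C1_on U g"
proof -
  have "x \<in> U \<Longrightarrow> f differentiable (at x) \<longleftrightarrow> g differentiable (at x)" 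
    "x \<in> U \<Longrightarrow> pd i f x = pd i g x" for x i
    using derivative_local[OF assms(1) _ assms(2)] by auto
  then show ?thesis unfolding C1_on_def by (auto cong: continuous_on_cong)
qed

lemma C1_on_Un:
  assumes "open U" "open V" "C1_on U f" "C1_on V f"
  shows "C1_on (U \<union> V) f"
  using assms unfolding C1_on_def by (auto intro: continuous_on_open_Un)

lemma C1_onI:
  assumes "\<And>x. x \<in> U \<Longrightarrow> (f has_derivative f' x) (at x)" "\<And>i. continuous_on U (\<lambda>x. f' x (axis i 1))"
  shows "C1_on U f"
  using assms unfolding C1_on_def differentiable_def
  by (metis (no_types, lifting) continuous_on_cong pd_eq)

lemma pd_const [simp]: "pd i (\<lambda>x. k) x = 0"
  by (simp add: pd_def)

lemma C1_on_const: "C1_on U (\<lambda>x. k)"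
  by (rule C1_onI[where f' = "\<lambda>x h. 0"]) auto

context
  fixes f g :: "real ^ 'n::finite \<Rightarrow> real"
begin

lemma pd_add:
  assumes "f differentiable (at x)" "g differentiable (at x)"
  shows "pd i (\<lambda>x. f x + g x) x = pd i f x + pd i g x"
  unfolding pd_def
  by (subst pd_eq[unfolded pd_def, OF has_derivative_add])
     (use assms in \<open>auto simp: frechet_derivative_works\<close>)

lemma pd_diff:
  assumes "f differentiable (at x)" "g differentiable (at x)"
  shows "pd i (\<lambda>x. f x - g x) x = pd i f x - pd i g x"
  unfolding pd_def
  by (subst pd_eq[unfolded pd_def, OF has_derivative_diff])
     (use assms in \<open>auto simp: frechet_derivative_works\<close>)

lemma pd_mult:
  assumes "f differentiable (at x)" "g differentiable (at x)"
  shows "pd i (\<lambda>x. f x * g x) x = pd i f x * g x + f x * pd i g x"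
  unfolding pd_def
  by (subst pd_eq[unfolded pd_def, OF has_derivative_mult])
     (use assms in \<open>auto simp: frechet_derivative_works\<close>)

lemma pd_divide:
  assumes "f differentiable (at x)" "g differentiable (at x)" "g x \<noteq> 0"
  shows "pd i (\<lambda>x. f x / g x) x = (pd i f x * g x - f x * pd i g x) / (g x * g x)"
  unfolding pd_def
  by (subst pd_eq[unfolded pd_def, OF has_derivative_divide'])
     (use assms in \<open>auto simp: frechet_derivative_works\<close>)

lemma pd_sqrt:
  assumes "f differentiable (at x)" "f x > 0"
  shows "pd i (\<lambda>x. sqrt (f x)) x = pd i f x / (2 * sqrt (f x))"
  unfolding pd_def
  by (subst pd_eq[unfolded pd_def, OF has_derivative_real_sqrt])
     (use assms in \<open>auto simp: frechet_derivative_works field_simps\<close>)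

lemma differentiable_sqrt:
  assumes "f differentiable (at x)" "f x > 0"
  shows "(\<lambda>x. sqrt (f x)) differentiable (at x)"
  using has_derivative_real_sqrt[where g = f and x = x, OF assms(2)] assms(1)
  unfolding differentiable_def by blast

lemma C1_on_add: "C1_on U f \<Longrightarrow> C1_on U g \<Longrightarrow> C1_on U (\<lambda>x. f x + g x)"
  unfolding C1_on_def
  by (auto intro!: continuous_intros continuous_on_cong[THEN iffD2, OF refl pd_add])

lemma C1_on_diff: "C1_on U f \<Longrightarrow> C1_on U g \<Longrightarrow> C1_on U (\<lambda>x. f x - g x)"
  unfolding C1_on_def
  by (auto intro!: continuous_intros continuous_on_cong[THEN iffD2, OF refl pd_diff])

lemma C1_on_mult: "C1_on U f \<Longrightarrow> C1_on U g \<Longrightarrow> C1_on U (\<lambda>x. f x * g x)"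
  using C1_on_imp_continuous_on[of U f] C1_on_imp_continuous_on[of U g] unfolding C1_on_def
  by (auto intro!: continuous_intros continuous_on_cong[THEN iffD2, OF refl pd_mult])

lemma C1_on_divide:
  assumes "C1_on U f" "C1_on U g" "\<And>x. x \<in> U \<Longrightarrow> g x \<noteq> 0"
  shows "C1_on U (\<lambda>x. f x / g x)"
  using C1_on_imp_continuous_on[of U f] C1_on_imp_continuous_on[of U g] assms unfolding C1_on_def
  by (auto intro!: continuous_intros continuous_on_cong[THEN iffD2, OF refl pd_divide])

lemma C1_on_sqrt:
  assumes "C1_on U f" "\<And>x. x \<in> U \<Longrightarrow> f x > 0"
  shows "C1_on U (\<lambda>x. sqrt (f x))"
  using C1_on_imp_continuous_on[of U f] assms differentiable_sqrt unfolding C1_on_def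
  by (auto intro!: continuous_intros continuous_on_cong[THEN iffD2, OF refl pd_sqrt]) 
     (metis less_irrefl)

end

lemma pd_cmult:
  assumes "f differentiable (at x)"
  shows "pd i (\<lambda>x. k * f x) x = k * pd i f x"
  using pd_mult[OF _ assms, of "\<lambda>x. k"] by simp

lemma pd_sum:
  fixes f :: "'b \<Rightarrow> real ^ 'n::finite \<Rightarrow> real"
  assumes "\<And>a. a \<in> S \<Longrightarrow> f a differentiable (at x)"
  shows "pd i (\<lambda>x. \<Sum>a\<in>S. f a x) x = (\<Sum>a\<in>S. pd i (f a) x)"
  using assms
proof (induction S rule: infinite_finite_induct)
  case (insert a S)
  then show ?case by (simp add: pd_add differentiable_sum)
qed auto

lemma C1_on_sum:
  fixes f :: "'b \<Rightarrow> real ^ 'n::finite \<Rightarrow> real"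
  assumes "\<And>a. a \<in> S \<Longrightarrow> C1_on U (f a)"
  shows "C1_on U (\<lambda>x. \<Sum>a\<in>S. f a x)"
  using assms
  by (induction S rule: infinite_finite_induct) (auto intro: C1_on_add C1_on_const)

lemma C1_on_prod:
  fixes f :: "'b \<Rightarrow> real ^ 'n::finite \<Rightarrow> real"
  assumes "\<And>a. a \<in> S \<Longrightarrow> C1_on U (f a)"
  shows "C1_on U (\<lambda>x. \<Prod>a\<in>S. f a x)"
  using assms
  by (induction S rule: infinite_finite_induct) (auto intro: C1_on_mult C1_on_const)

lemma pd_vec_nth:
  assumes "(f has_derivative f') (at x)"
  shows "(\<lambda>x. f x $ j) differentiable (at x)" "pd i (\<lambda>x. f x $ j) x = f' (axis i 1) $ j"
proof -
  have "((\<lambda>x. f x $ j) has_derivative (\<lambda>h. f' h $ j)) (at x)"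
    by (rule bounded_linear.has_derivative[OF bounded_linear_vec_nth assms])
  then show "(\<lambda>x. f x $ j) differentiable (at x)" "pd i (\<lambda>x. f x $ j) x = f' (axis i 1) $ j"
    using pd_eq differentiable_def by (blast, blast)
qed

lemma pd_compose:
  assumes f: "f differentiable (at (\<phi> x))" and \<phi>: "\<phi> differentiable (at x)"
  shows "(\<lambda>x. f (\<phi> x)) differentiable (at x)"
    and "pd i (\<lambda>x. f (\<phi> x)) x = (\<Sum>j\<in>UNIV. pd i (\<lambda>x. \<phi> x $ j) x * pd j f (\<phi> x))"
proof -
  from \<phi> obtain \<phi>' where \<phi>': "(\<phi> has_derivative \<phi>') (at x)" unfolding differentiable_def by blast
  have "((\<lambda>x. f (\<phi> x)) has_derivative (\<lambda>h. \<Sum>j\<in>UNIV. \<phi>' h $ j * pd j f (\<phi> x))) (at x)"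
    using has_derivative_compose[OF \<phi>' has_derivative_pd[OF f]] by simp
  then show "(\<lambda>x. f (\<phi> x)) differentiable (at x)"
      "pd i (\<lambda>x. f (\<phi> x)) x = (\<Sum>j\<in>UNIV. pd i (\<lambda>x. \<phi> x $ j) x * pd j f (\<phi> x))"
    using differentiable_def apply blast
    using pd_vec_nth[OF \<phi>'] pd_eq[OF \<open>((\<lambda>x. f (\<phi> x)) has_derivative _) (at x)\<close>] by simp
qed

lemma C1_on_compose:
  assumes f: "C1_on V f" and \<phi>: "\<And>x. x \<in> U \<Longrightarrow> \<phi> differentiable (at x)"
    and \<phi>': "\<And>j. C1_on U (\<lambda>x. \<phi> x $ j)" and sub: "\<phi> ` U \<subseteq> V"
  shows "C1_on U (\<lambda>x. f (\<phi> x))"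
proof -
  have c\<phi>: "continuous_on U \<phi>"
    using \<phi> by (meson differentiable_imp_continuous_within continuous_at_imp_continuous_on)
  have "continuous_on U (pd i (\<lambda>x. f (\<phi> x)))" for i
  proof -
    have "continuous_on U (\<lambda>x. \<Sum>j\<in>UNIV. pd i (\<lambda>x. \<phi> x $ j) x * pd j f (\<phi> x))"
      using \<phi>' f sub
      by (intro continuous_intros C1_on_continuous_pd continuous_on_compose2[OF C1_on_continuous_pd[OF f] c\<phi>]) auto
    moreover have "x \<in> U \<Longrightarrow> pd i (\<lambda>x. f (\<phi> x)) x = (\<Sum>j\<in>UNIV. pd i (\<lambda>x. \<phi> x $ j) x * pd j f (\<phi> x))" for x
      by (rule pd_compose) (use C1_on_differentiable[OF f] sub \<phi> in auto)
    ultimately show ?thesis by (simp cong: continuous_on_cong)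
  qed
  then show ?thesis unfolding C1_on_def
    using pd_compose(1) C1_on_differentiable[OF f] sub \<phi> by (metis image_subset_iff)
qed

lemma smooth_on_C1_components:
  fixes f :: "real ^ 'n::finite \<Rightarrow> real ^ 'm::finite"
  assumes "smooth_on U f"
  shows "\<And>x. x \<in> U \<Longrightarrow> f differentiable (at x)" and "C1_on U (\<lambda>x. f x $ j)"
proof -
  have *: "Ck_on (Suc 0) U f" using assms unfolding smooth_on_def by blast
  then show d: "f differentiable (at x)" if "x \<in> U" for x using that by simp
  show "C1_on U (\<lambda>x. f x $ j)"
  proof (rule C1_onI)
    show "((\<lambda>x. f x $ j) has_derivative (\<lambda>h. frechet_derivative f (at x) h $ j)) (at x)" if "x \<in> U" for x
      using d[OF that] 
      by (intro bounded_linear.has_derivative[OF bounded_linear_vec_nth]) (simp add: frechet_derivative_works)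
    show "continuous_on U (\<lambda>x. frechet_derivative f (at x) (axis i 1) $ j)" for i
      using * by (intro continuous_intros) auto
  qed
qed

lemma smooth_on_C1_entries:
  fixes f :: "real ^ 'n::finite \<Rightarrow> real ^ 'm::finite ^ 'k::finite"
  assumes "smooth_on U f"
  shows "C1_on U (\<lambda>x. f x $ i $ j)"
proof -
  have *: "Ck_on (Suc 0) U f" using assms unfolding smooth_on_def by blast
  show ?thesis
  proof (rule C1_onI)
    show "((\<lambda>x. f x $ i $ j) has_derivative (\<lambda>h. frechet_derivative f (at x) h $ i $ j)) (at x)" if "x \<in> U" for x
      using * that
      by (intro bounded_linear.has_derivative[OF bounded_linear_vec_nth]) (simp add: frechet_derivative_works)
    show "continuous_on U (\<lambda>x. frechet_derivative f (at x) (axis k 1) $ i $ j)" for k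
      using * by (intro continuous_intros) auto
  qed
qed

section \<open>Derivatives of the inverse and the determinant of a matrix\<close>

lemma matrix_inv_mult:
  fixes A :: "real ^ 'n ^ 'n"
  assumes "det A \<noteq> 0"
  shows "A ** matrix_inv A = mat 1" "matrix_inv A ** A = mat 1"
proof -
  have "\<exists>B. A ** B = mat 1 \<and> B ** A = mat 1"
    using assms by (simp add: invertible_det_nz[symmetric] invertible_def)
  then have "A ** matrix_inv A = mat 1 \<and> matrix_inv A ** A = mat 1"
    unfolding matrix_inv_def by (rule someI_ex)
  then show "A ** matrix_inv A = mat 1" "matrix_inv A ** A = mat 1" by auto
qed

lemma matrix_inv_unique:
  fixes A :: "real ^ 'n ^ 'n"
  assumes "A ** B = mat 1"
  shows "matrix_inv A = B"
proof -
  have "det A * det B = 1" using assms by (metis det_I det_mul)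
  then have "det A \<noteq> 0" by auto
  then show ?thesis using matrix_inv_mult(2)[of A] assms
    by (metis matrix_mul_assoc matrix_mul_lid matrix_mul_rid)
qed

lemma transpose_matrix_inv:
  fixes A :: "real ^ 'n ^ 'n"
  assumes "det A \<noteq> 0"
  shows "transpose (matrix_inv A) = matrix_inv (transpose A)"
  by (rule matrix_inv_unique[symmetric])
     (metis assms matrix_inv_mult(2) matrix_transpose_mul transpose_mat)

lemma matrix_mult_nth: "(A ** B) $ i $ j = (\<Sum>k\<in>UNIV. A $ i $ k * B $ k $ j)"
  by (simp add: matrix_matrix_mult_def)

lemma C1_on_det:
  fixes M :: "real ^ 'n \<Rightarrow> real ^ 'm ^ 'm"
  assumes "\<And>i j. C1_on U (\<lambda>x. M x $ i $ j)"
  shows "C1_on U (\<lambda>x. det (M x))"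
  unfolding det_def by (intro C1_on_sum C1_on_mult C1_on_prod C1_on_const assms)

text \<open>Cramer's rule writes the entries of the inverse as quotients of polynomials in the entries of
  the matrix, which is why inversion preserves differentiability.\<close>

lemma matrix_inv_cramer:
  fixes A :: "real ^ 'n ^ 'n"
  assumes "det A \<noteq> 0"
  shows "matrix_inv A $ i $ j = det (\<chi> a b. if b = i then (if a = j then 1 else 0) else A $ a $ b) / det A"
proof -
  let ?x = "\<chi> i. matrix_inv A $ i $ j"
  have "A *v ?x = (\<chi> a. if a = j then 1 else 0)"
    using matrix_inv_mult(1)[OF assms]
    by (simp add: vec_eq_iff matrix_vector_mult_def matrix_mult_nth[symmetric] mat_def)
  then have "?x = (\<chi> k. det (\<chi> i' j'. if j' = k then (\<chi> a. if a = j then 1 else 0) $ i' else A $ i' $ j') / det A)"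
    using cramer[OF assms] by blast
  then have "?x $ i = (\<chi> k. det (\<chi> i' j'. if j' = k then (\<chi> a. if a = j then 1 else 0) $ i' else A $ i' $ j') / det A) $ i"
    by (rule arg_cong)
  then show ?thesis by (simp cong: if_cong)
qed

lemma C1_on_matrix_inv:
  fixes M :: "real ^ 'n \<Rightarrow> real ^ 'm ^ 'm"
  assumes U: "open U" and M: "\<And>i j. C1_on U (\<lambda>x. M x $ i $ j)" and d: "\<And>x. x \<in> U \<Longrightarrow> det (M x) \<noteq> 0"
  shows "C1_on U (\<lambda>x. matrix_inv (M x) $ i $ j)"
proof -
  have C: "C1_on U (\<lambda>x. det (\<chi> a b. if b = i then (if a = j then 1 else 0) else M x $ a $ b) / det (M x))"
  proof (rule C1_on_divide[OF _ C1_on_det[OF M] d])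
    show "C1_on U (\<lambda>x. det (\<chi> a b. if b = i then (if a = j then 1 else 0) else M x $ a $ b))"
    proof (rule C1_on_det)
      fix a b show "C1_on U (\<lambda>x. (\<chi> a b. if b = i then (if a = j then 1 else 0) else M x $ a $ b) $ a $ b)"
        by (cases "b = i") (auto intro: C1_on_const M)
    qed
  qed
  show ?thesis
    by (rule iffD2[OF C1_on_cong[OF U matrix_inv_cramer[OF d]] C])
qed

text \<open>The formula \<partial>(M^-1) = - M^-1 (\<partial>M) M^-1, obtained by differentiating M M^-1 = 1.\<close>

lemma pd_matrix_inv:
  fixes M :: "real ^ 'n \<Rightarrow> real ^ 'm ^ 'm"
  assumes U: "open U" and M: "\<And>i j. C1_on U (\<lambda>x. M x $ i $ j)" and d: "\<And>x. x \<in> U \<Longrightarrow> det (M x) \<noteq> 0"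
    and x: "x \<in> U"
  shows "pd k (\<lambda>x. matrix_inv (M x) $ i $ j) x =
    - (\<Sum>a\<in>UNIV. \<Sum>b\<in>UNIV. matrix_inv (M x) $ i $ a * pd k (\<lambda>x. M x $ a $ b) x * matrix_inv (M x) $ b $ j)"
proof -
  let ?G = "\<lambda>x. matrix_inv (M x)"
  have dM: "(\<lambda>x. M x $ a $ b) differentiable (at x)" for a b
    using C1_on_differentiable[OF M x] .
  have dG: "(\<lambda>x. ?G x $ a $ b) differentiable (at x)" for a b
    using C1_on_differentiable[OF C1_on_matrix_inv[OF U M d] x] .
  have *: "(\<Sum>b\<in>UNIV. pd k (\<lambda>x. M x $ a $ b) x * ?G x $ b $ j + M x $ a $ b * pd k (\<lambda>x. ?G x $ b $ j) x) = 0" for a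
  proof -
    have "(\<Sum>b\<in>UNIV. M y $ a $ b * ?G y $ b $ j) = (if a = j then 1 else 0)" if "y \<in> U" for y
      using matrix_inv_mult(1)[OF d[OF that]] by (simp add: matrix_mult_nth[symmetric] mat_def)
    then have "pd k (\<lambda>y. \<Sum>b\<in>UNIV. M y $ a $ b * ?G y $ b $ j) x = pd k (\<lambda>y. if a = j then 1 else 0) x"
      by (intro derivative_local(2)[OF U x])
    then show ?thesis using dM dG by (simp add: pd_sum pd_mult)
  qed
  have "0 = (\<Sum>a\<in>UNIV. ?G x $ i $ a * (\<Sum>b\<in>UNIV. pd k (\<lambda>x. M x $ a $ b) x * ?G x $ b $ j + M x $ a $ b * pd k (\<lambda>x. ?G x $ b $ j) x))"
    by (simp only: *) simp
  also have "\<dots> = (\<Sum>a\<in>UNIV. \<Sum>b\<in>UNIV. ?G x $ i $ a * pd k (\<lambda>x. M x $ a $ b) x * ?G x $ b $ j)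
     + (\<Sum>a\<in>UNIV. \<Sum>b\<in>UNIV. ?G x $ i $ a * M x $ a $ b * pd k (\<lambda>x. ?G x $ b $ j) x)"
    by (simp add: sum_distrib_left sum.distrib distrib_left mult_ac)
  also have "(\<Sum>a\<in>UNIV. \<Sum>b\<in>UNIV. ?G x $ i $ a * M x $ a $ b * pd k (\<lambda>x. ?G x $ b $ j) x)
     = (\<Sum>b\<in>UNIV. (?G x ** M x) $ i $ b * pd k (\<lambda>x. ?G x $ b $ j) x)"
    unfolding matrix_mult_nth sum_distrib_right by (rule sum.swap)
  also have "\<dots> = pd k (\<lambda>x. ?G x $ i $ j) x"
    using matrix_inv_mult(2)[OF d[OF x]]
    by (simp add: mat_def if_distrib[of "\<lambda>y. y * _"] cong: if_cong)
  finally show ?thesis by simp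
qed

text \<open>Jacobi's formula. By the product rule the derivative is a sum over i of the determinants in which
  row i of M is replaced by row i of \<partial>M. Since \<partial>M = K M with K = (\<partial>M) M^-1, that row is a
  combination of the rows of M in which row i has coefficient K_ii, so the determinant is K_ii det M.
  The sum is det M times the trace of K.\<close>

lemma pd_det:
  fixes M :: "real ^ 'n \<Rightarrow> real ^ 'm ^ 'm"
  assumes M: "\<And>i j. (\<lambda>x. M x $ i $ j) differentiable (at x)" and d: "det (M x) \<noteq> 0"
  shows "pd k (\<lambda>x. det (M x)) x =
    det (M x) * (\<Sum>i\<in>UNIV. \<Sum>j\<in>UNIV. matrix_inv (M x) $ i $ j * pd k (\<lambda>x. M x $ j $ i) x)"
proof -
  \<comment> \<open>D is the derivative of M; row i of D is the combination of rows of M with coefficients K_i.\<close>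
  define D :: "real^'m^'m" where "D = (\<chi> i j. pd k (\<lambda>x. M x $ i $ j) x)"
  define K where "K = D ** matrix_inv (M x)"
  have KM: "K ** M x = D"
    unfolding K_def using matrix_inv_mult(2)[OF d] by (metis matrix_mul_assoc matrix_mul_rid)
  let ?P = "{p. p permutes (UNIV::'m set)}"
  let ?R = "\<lambda>i. (\<chi> r. if r = i then D $ i else M x $ r) :: real^'m^'m"
  have prod: "((\<lambda>x. \<Prod>i\<in>UNIV. M x $ i $ p i) has_derivative 
     (\<lambda>y. \<Sum>i\<in>UNIV. frechet_derivative (\<lambda>x. M x $ i $ p i) (at x) y * (\<Prod>j\<in>UNIV - {i}. M x $ j $ p j))) (at x)" for p
    using M by (intro has_derivative_prod) (simp add: frechet_derivative_works)
  have pd_prod: "pd k (\<lambda>x. \<Prod>i\<in>UNIV. M x $ i $ p i) x = (\<Sum>i\<in>UNIV. D $ i $ p i * (\<Prod>j\<in>UNIV - {i}. M x $ j $ p j))" for p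
    using pd_eq[OF prod] by (simp add: D_def pd_def)
  have "pd k (\<lambda>x. det (M x)) x = (\<Sum>p\<in>?P. of_int (sign p) * (\<Sum>i\<in>UNIV. D $ i $ p i * (\<Prod>j\<in>UNIV - {i}. M x $ j $ p j)))"
    unfolding det_def
    by (subst pd_sum) (auto simp: pd_cmult[OF differentiableI[OF prod]] pd_prod intro!: differentiable_mult differentiableI[OF prod])
  also have "\<dots> = (\<Sum>i\<in>UNIV. \<Sum>p\<in>?P. of_int (sign p) * (D $ i $ p i * (\<Prod>j\<in>UNIV - {i}. M x $ j $ p j)))"
    unfolding sum_distrib_left by (rule sum.swap)
  also have "\<dots> = (\<Sum>i\<in>UNIV. det (?R i))"
  proof (rule sum.cong[OF refl])
    fix i :: 'm
    have "(\<Prod>j\<in>UNIV. ?R i $ j $ p j) = D $ i $ p i * (\<Prod>j\<in>UNIV - {i}. M x $ j $ p j)" for p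
      by (subst prod.remove[of _ i]) (auto intro!: prod.cong)
    then show "(\<Sum>p\<in>?P. of_int (sign p) * (D $ i $ p i * (\<Prod>j\<in>UNIV - {i}. M x $ j $ p j))) = det (?R i)"
      unfolding det_def by simp
  qed
  also have "\<dots> = (\<Sum>i\<in>UNIV. K $ i $ i * det (M x))"
  proof (rule sum.cong[OF refl])
    fix i :: 'm
    have "(\<Sum>l\<in>UNIV. K $ i $ l *s row l (M x)) = D $ i"
      using KM by (auto simp: vec_eq_iff row_def matrix_mult_nth)
    then have "?R i = (\<chi> r. if r = i then \<Sum>l\<in>UNIV. K $ i $ l *s row l (M x) else row r (M x))"
      by (simp add: row_def vec_eq_iff)
    then show "det (?R i) = K $ i $ i * det (M x)"
      using cramer_lemma_transpose[of i "K $ i" "M x"] by simp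
  qed
  also have "\<dots> = det (M x) * (\<Sum>i\<in>UNIV. \<Sum>j\<in>UNIV. D $ i $ j * matrix_inv (M x) $ j $ i)"
    by (simp add: K_def matrix_mult_nth sum_distrib_left sum_distrib_right mult_ac)
  also have "(\<Sum>i\<in>UNIV. \<Sum>j\<in>UNIV. D $ i $ j * matrix_inv (M x) $ j $ i) = 
     (\<Sum>i\<in>UNIV. \<Sum>j\<in>UNIV. matrix_inv (M x) $ i $ j * pd k (\<lambda>x. M x $ j $ i) x)"
    by (subst sum.swap) (simp add: D_def mult_ac)
  finally show ?thesis .
qed

section \<open>The divergence of X and of q(X) at a point\<close>

text \<open>Exchanges the pairs (i, k) and (l, m) in a fourfold contraction. Two terms of the Christoffel
  symbols cancel by this exchange.\<close>

lemma sum_swap_pairs: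
  fixes f :: "'n::finite \<Rightarrow> 'n \<Rightarrow> 'n \<Rightarrow> 'n \<Rightarrow> real"
  shows "(\<Sum>i\<in>UNIV. \<Sum>k\<in>UNIV. \<Sum>l\<in>UNIV. \<Sum>m\<in>UNIV. f i k l m) = (\<Sum>i\<in>UNIV. \<Sum>k\<in>UNIV. \<Sum>l\<in>UNIV. \<Sum>m\<in>UNIV. f l m i k)"
proof -
  have "(\<Sum>i\<in>UNIV. \<Sum>k\<in>UNIV. \<Sum>l\<in>UNIV. \<Sum>m\<in>UNIV. f i k l m) = 
     (\<Sum>x\<in>UNIV\<times>UNIV. \<Sum>y\<in>UNIV\<times>UNIV. f (fst x) (snd x) (fst y) (snd y))"
    by (simp add: sum.cartesian_product' del: UNIV_Times_UNIV)
  also have "\<dots> = (\<Sum>y\<in>UNIV\<times>UNIV. \<Sum>x\<in>UNIV\<times>UNIV. f (fst x) (snd x) (fst y) (snd y))"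
    by (rule sum.swap)
  finally show ?thesis
    by (simp add: sum.cartesian_product' del: UNIV_Times_UNIV)
qed

lemma sum_rotate3:
  fixes f :: "'n::finite \<Rightarrow> 'n \<Rightarrow> 'n \<Rightarrow> real"
  shows "(\<Sum>i\<in>UNIV. \<Sum>k\<in>UNIV. \<Sum>l\<in>UNIV. f i k l) = (\<Sum>l\<in>UNIV. \<Sum>i\<in>UNIV. \<Sum>k\<in>UNIV. f i k l)"
proof -
  have "(\<Sum>i\<in>UNIV. \<Sum>k\<in>UNIV. \<Sum>l\<in>UNIV. f i k l) = (\<Sum>i\<in>UNIV. \<Sum>l\<in>UNIV. \<Sum>k\<in>UNIV. f i k l)"
    by (rule sum.cong[OF refl], rule sum.swap)
  then show ?thesis by (simp only: sum.swap[of "\<lambda>i l. \<Sum>k\<in>UNIV. f i k l"])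
qed

text \<open>Everything in this context happens at one point in one chart: \<open>g\<close> and \<open>q\<close> are the components of
  the two tensors, \<open>G\<close> is the inverse of \<open>g\<close>, \<open>X\<close> are the components of the vector field, \<open>dg k i j\<close>
  and \<open>dq k i j\<close> stand for the derivatives \<partial>_k g_ij and \<partial>_k q_ij, and \<open>dX i k\<close> stands for
  \<partial>_i X^k. The derivatives are arbitrary real numbers here, so the results are purely algebraic.

  The contractions that occur have names: \<open>metric_div\<close> is G^lm G^ik \<partial>_k g_im, \<open>log_det_grad\<close> is the
  gradient of log (det g), \<open>raised\<close> is q^km with both indices raised, \<open>raised_dot_dg\<close> is
  q^km \<partial>_j g_km, \<open>chris\<close> are the Christoffel symbols and \<open>q_dX\<close> is q^i_j \<partial>_i X^j.\<close>

context
  fixes g G q :: "'n::finite \<Rightarrow> 'n \<Rightarrow> real" and dg dq :: "'n \<Rightarrow> 'n \<Rightarrow> 'n \<Rightarrow> real"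
    and X :: "'n \<Rightarrow> real" and dX :: "'n \<Rightarrow> 'n \<Rightarrow> real" and \<sigma> :: real
begin

definition metric_div where "metric_div l = (\<Sum>i\<in>UNIV. \<Sum>k\<in>UNIV. \<Sum>m\<in>UNIV. G i k * G l m * dg k i m)"
definition log_det_grad where "log_det_grad l = (\<Sum>i\<in>UNIV. \<Sum>k\<in>UNIV. \<Sum>m\<in>UNIV. G i k * G l m * dg m k i)"
definition raised where "raised k m = (\<Sum>i\<in>UNIV. \<Sum>l\<in>UNIV. G k i * q i l * G l m)"
definition raised_dot_dg where "raised_dot_dg j = (\<Sum>k\<in>UNIV. \<Sum>m\<in>UNIV. raised k m * dg j k m)"
definition chris where "chris l k i = (1/2) * (\<Sum>m\<in>UNIV. G l m * (dg k i m + dg i k m - dg m k i))"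
definition q_dX where "q_dX = (\<Sum>i\<in>UNIV. \<Sum>k\<in>UNIV. \<Sum>j\<in>UNIV. G i k * q k j * dX i j)"
definition tensor_tr where "tensor_tr = (\<Sum>i\<in>UNIV. \<Sum>j\<in>UNIV. G i j * q i j)"

context
  assumes g_sym: "\<And>i j. g i j = g j i" and G_sym: "\<And>i j. G i j = G j i"
    and q_sym: "\<And>i j. q i j = q j i" and dg_sym: "\<And>k i j. dg k i j = dg k j i"
    and inv: "\<And>i j. (\<Sum>a\<in>UNIV. g i a * G a j) = (if i = j then 1 else 0)"
    and conformal: "\<And>i j. (\<Sum>k\<in>UNIV. X k * dg k i j + g k j * dX i k + g i k * dX j k) = 2 * \<sigma> * g i j"
begin

lemma inv_left: "(\<Sum>a\<in>UNIV. G i a * g a j) = (if i = j then 1 else 0)"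
  using inv[of j i] by (simp add: mult.commute g_sym[of j] G_sym[of _ i] cong: if_cong)

text \<open>div X = n \<sigma>: the trace of the conformal equation is X^k G^ij \<partial>_k g_ij + 2 \<partial>_i X^i
  = 2 n \<sigma>, and by Jacobi's formula G^ij \<partial>_k g_ij is the logarithmic derivative of det g.\<close>

lemma divergence_conformal:
  "(\<Sum>i\<in>UNIV. dX i i) + (1/2) * (\<Sum>i\<in>UNIV. X i * (\<Sum>a\<in>UNIV. \<Sum>b\<in>UNIV. G a b * dg i a b)) = real CARD('n) * \<sigma>"
proof -
  have "(\<Sum>i\<in>UNIV. \<Sum>j\<in>UNIV. G i j * (\<Sum>k\<in>UNIV. X k * dg k i j + g k j * dX i k + g i k * dX j k))
    = (\<Sum>i\<in>UNIV. \<Sum>j\<in>UNIV. G i j * (2 * \<sigma> * g i j))"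
    by (simp only: conformal)
  also have "\<dots> = 2 * \<sigma> * (\<Sum>i\<in>UNIV. \<Sum>j\<in>UNIV. G i j * g j i)"
    by (simp add: sum_distrib_left mult_ac g_sym)
  also have "\<dots> = 2 * \<sigma> * real CARD('n)"
    by (simp add: inv_left)
  finally have 1: "(\<Sum>i\<in>UNIV. \<Sum>j\<in>UNIV. G i j * (\<Sum>k\<in>UNIV. X k * dg k i j + g k j * dX i k + g i k * dX j k))
     = 2 * \<sigma> * real CARD('n)" .
  have 2: "(\<Sum>i\<in>UNIV. \<Sum>j\<in>UNIV. G i j * (\<Sum>k\<in>UNIV. X k * dg k i j)) 
      = (\<Sum>i\<in>UNIV. X i * (\<Sum>a\<in>UNIV. \<Sum>b\<in>UNIV. G a b * dg i a b))"
    using sum_rotate3[of "\<lambda>i j k. G i j * (X k * dg k i j)"]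
    by (simp add: sum_distrib_left mult_ac)
  have 3: "(\<Sum>i\<in>UNIV. \<Sum>j\<in>UNIV. G i j * (\<Sum>k\<in>UNIV. g k j * dX i k)) = (\<Sum>i\<in>UNIV. dX i i)"
  proof (rule sum.cong[OF refl])
    fix i
    have "(\<Sum>j\<in>UNIV. G i j * (\<Sum>k\<in>UNIV. g k j * dX i k)) = (\<Sum>k\<in>UNIV. \<Sum>j\<in>UNIV. G i j * (g k j * dX i k))"
      unfolding sum_distrib_left by (rule sum.swap)
    also have "\<dots> = (\<Sum>k\<in>UNIV. (\<Sum>j\<in>UNIV. G i j * g j k) * dX i k)"
      by (simp add: sum_distrib_left sum_distrib_right mult_ac g_sym)
    finally have "(\<Sum>j\<in>UNIV. G i j * (\<Sum>k\<in>UNIV. g k j * dX i k)) = (\<Sum>k\<in>UNIV. (\<Sum>j\<in>UNIV. G i j * g j k) * dX i k)" .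
    then show "(\<Sum>j\<in>UNIV. G i j * (\<Sum>k\<in>UNIV. g k j * dX i k)) = dX i i"
      by (simp add: inv_left if_distrib[of "\<lambda>x. x * _"] cong: if_cong)
  qed
  have 4: "(\<Sum>i\<in>UNIV. \<Sum>j\<in>UNIV. G i j * (\<Sum>k\<in>UNIV. g i k * dX j k)) = (\<Sum>i\<in>UNIV. dX i i)"
    unfolding 3[symmetric] by (subst sum.swap) (simp add: g_sym G_sym)
  have "2 * (\<Sum>i\<in>UNIV. dX i i) + (\<Sum>i\<in>UNIV. X i * (\<Sum>a\<in>UNIV. \<Sum>b\<in>UNIV. G a b * dg i a b))
      = 2 * (real CARD('n) * \<sigma>)"
    using 1 2 3 4 by (simp add: sum.distrib distrib_left)
  then show ?thesis by linarith
qed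


lemma raised_dot_dg_alt: "raised_dot_dg j = (\<Sum>i\<in>UNIV. \<Sum>k\<in>UNIV. \<Sum>l\<in>UNIV. \<Sum>m\<in>UNIV. G i k * G l m * q i l * dg j k m)"
proof -
  have "raised_dot_dg j = (\<Sum>k\<in>UNIV. \<Sum>m\<in>UNIV. \<Sum>i\<in>UNIV. \<Sum>l\<in>UNIV. G i k * G l m * q i l * dg j k m)"
    unfolding raised_dot_dg_def raised_def by (simp add: sum_distrib_left sum_distrib_right mult_ac G_sym)
  also have "\<dots> = (\<Sum>k\<in>UNIV. \<Sum>i\<in>UNIV. \<Sum>l\<in>UNIV. \<Sum>m\<in>UNIV. G i k * G l m * q i l * dg j k m)"
    by (rule sum.cong[OF refl], rule sum_rotate3[symmetric])
  also have "\<dots> = (\<Sum>i\<in>UNIV. \<Sum>k\<in>UNIV. \<Sum>l\<in>UNIV. \<Sum>m\<in>UNIV. G i k * G l m * q i l * dg j k m)"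
    by (rule sum.swap)
  finally show ?thesis .
qed

text \<open>The well-known contraction of the Christoffel symbols in their lower indices. The two
  derivatives of g that are symmetric in these indices contribute equally.\<close>

lemma chris_contract: "(\<Sum>i\<in>UNIV. \<Sum>k\<in>UNIV. G i k * chris l k i) = metric_div l - log_det_grad l / 2"
proof -
  have "(\<Sum>i\<in>UNIV. \<Sum>k\<in>UNIV. \<Sum>m\<in>UNIV. G i k * G l m * dg i k m) = metric_div l"
    unfolding metric_div_def by (subst sum.swap) (simp add: G_sym)
  moreover have "(\<Sum>i\<in>UNIV. \<Sum>k\<in>UNIV. G i k * chris l k i) = (1/2) *
     (metric_div l + (\<Sum>i\<in>UNIV. \<Sum>k\<in>UNIV. \<Sum>m\<in>UNIV. G i k * G l m * dg i k m) - log_det_grad l)"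
    unfolding chris_def metric_div_def log_det_grad_def
    by (simp add: sum_distrib_left distrib_left right_diff_distrib sum.distrib sum_subtractf mult_ac
         flip: sum_divide_distrib)
  ultimately show ?thesis by simp
qed

lemma chris_term1:
  "(\<Sum>i\<in>UNIV. \<Sum>k\<in>UNIV. G i k * (\<Sum>l\<in>UNIV. chris l k i * q l j)) = (\<Sum>l\<in>UNIV. q l j * (metric_div l - log_det_grad l / 2))"
proof -
  have "(\<Sum>i\<in>UNIV. \<Sum>k\<in>UNIV. G i k * (\<Sum>l\<in>UNIV. chris l k i * q l j)) =
     (\<Sum>l\<in>UNIV. \<Sum>i\<in>UNIV. \<Sum>k\<in>UNIV. G i k * (chris l k i * q l j))"
    unfolding sum_distrib_left by (rule sum_rotate3)
  also have "\<dots> = (\<Sum>l\<in>UNIV. q l j * (\<Sum>i\<in>UNIV. \<Sum>k\<in>UNIV. G i k * chris l k i))"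
    by (simp add: sum_distrib_left mult_ac)
  finally show ?thesis by (simp only: chris_contract)
qed

text \<open>Since q^km is symmetric in k and m, the terms \<partial>_k g_jm and - \<partial>_m g_kj of the
  Christoffel symbol cancel and only \<partial>_j g_km is left.\<close>

lemma chris_term2:
  "(\<Sum>i\<in>UNIV. \<Sum>k\<in>UNIV. G i k * (\<Sum>l\<in>UNIV. chris l k j * q i l)) = raised_dot_dg j / 2"
proof -
  let ?f = "\<lambda>i k l m. G i k * G l m * q i l * dg k j m"
  have "(\<Sum>i\<in>UNIV. \<Sum>k\<in>UNIV. G i k * (\<Sum>l\<in>UNIV. chris l k j * q i l)) = (1/2) *
    ((\<Sum>i\<in>UNIV. \<Sum>k\<in>UNIV. \<Sum>l\<in>UNIV. \<Sum>m\<in>UNIV. ?f i k l m) + raised_dot_dg j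
     - (\<Sum>i\<in>UNIV. \<Sum>k\<in>UNIV. \<Sum>l\<in>UNIV. \<Sum>m\<in>UNIV. ?f l m i k))"
    unfolding chris_def raised_dot_dg_alt
    by (simp add: sum_distrib_left sum_distrib_right distrib_left distrib_right right_diff_distrib left_diff_distrib sum.distrib sum_subtractf mult_ac
         q_sym dg_sym flip: sum_divide_distrib)
  also have "\<dots> = raised_dot_dg j / 2" using sum_swap_pairs[of ?f] by simp
  finally show ?thesis .
qed

lemma raised_g: "(\<Sum>j\<in>UNIV. raised i j * g j k) = (\<Sum>a\<in>UNIV. G i a * q a k)"
proof -
  have "(\<Sum>j\<in>UNIV. raised i j * g j k) = (\<Sum>j\<in>UNIV. \<Sum>a\<in>UNIV. \<Sum>b\<in>UNIV. G i a * q a b * (G b j * g j k))"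
    unfolding raised_def by (simp add: sum_distrib_left sum_distrib_right mult_ac)
  also have "\<dots> = (\<Sum>a\<in>UNIV. \<Sum>b\<in>UNIV. G i a * q a b * (\<Sum>j\<in>UNIV. G b j * g j k))"
    unfolding sum_distrib_left by (rule sum_rotate3[symmetric])
  also have "\<dots> = (\<Sum>a\<in>UNIV. G i a * q a k)"
    by (simp add: inv_left if_distrib[of "\<lambda>x. _ * x"] cong: if_cong)
  finally show ?thesis .
qed

lemma raised_sym: "raised i j = raised j i"
  unfolding raised_def by (subst sum.swap) (simp add: G_sym q_sym mult_ac)

text \<open>The contraction of the conformal equation with q^ij. Without covariant derivatives
  it is the statement q^ij \<nabla>_i X_j = \<sigma> tr q: the first sum contains the Christoffel part of
  the covariant derivative.\<close>

lemma raised_contraction: "(\<Sum>j\<in>UNIV. X j * raised_dot_dg j) + 2 * q_dX = 2 * \<sigma> * tensor_tr"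
proof -
  have "(\<Sum>i\<in>UNIV. \<Sum>j\<in>UNIV. raised i j * (\<Sum>k\<in>UNIV. X k * dg k i j + g k j * dX i k + g i k * dX j k))
    = (\<Sum>i\<in>UNIV. \<Sum>j\<in>UNIV. raised i j * (2 * \<sigma> * g i j))"
    by (simp only: conformal)
  also have "\<dots> = 2 * \<sigma> * (\<Sum>i\<in>UNIV. \<Sum>j\<in>UNIV. raised i j * g j i)"
    by (simp add: sum_distrib_left mult_ac g_sym)
  also have "\<dots> = 2 * \<sigma> * tensor_tr"
    by (simp add: raised_g tensor_tr_def q_sym)
  finally have 1: "(\<Sum>i\<in>UNIV. \<Sum>j\<in>UNIV. raised i j * (\<Sum>k\<in>UNIV. X k * dg k i j + g k j * dX i k + g i k * dX j k))
     = 2 * \<sigma> * tensor_tr" .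
  have 2: "(\<Sum>i\<in>UNIV. \<Sum>j\<in>UNIV. raised i j * (\<Sum>k\<in>UNIV. X k * dg k i j)) = (\<Sum>j\<in>UNIV. X j * raised_dot_dg j)"
    using sum_rotate3[of "\<lambda>i j k. raised i j * (X k * dg k i j)"]
    by (simp add: raised_dot_dg_def sum_distrib_left mult_ac)
  have 3: "(\<Sum>i\<in>UNIV. \<Sum>j\<in>UNIV. raised i j * (\<Sum>k\<in>UNIV. g k j * dX i k)) = q_dX"
    unfolding q_dX_def
  proof (rule sum.cong[OF refl])
    fix i
    have "(\<Sum>j\<in>UNIV. raised i j * (\<Sum>k\<in>UNIV. g k j * dX i k)) = (\<Sum>k\<in>UNIV. \<Sum>j\<in>UNIV. raised i j * (g k j * dX i k))"
      unfolding sum_distrib_left by (rule sum.swap)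
    also have "\<dots> = (\<Sum>k\<in>UNIV. (\<Sum>j\<in>UNIV. raised i j * g j k) * dX i k)"
      by (simp add: sum_distrib_left sum_distrib_right mult_ac g_sym)
    finally have "(\<Sum>j\<in>UNIV. raised i j * (\<Sum>k\<in>UNIV. g k j * dX i k)) = (\<Sum>k\<in>UNIV. (\<Sum>j\<in>UNIV. raised i j * g j k) * dX i k)" .
    then show "(\<Sum>j\<in>UNIV. raised i j * (\<Sum>k\<in>UNIV. g k j * dX i k)) = (\<Sum>k\<in>UNIV. \<Sum>j\<in>UNIV. G i k * q k j * dX i j)"
      by (subst sum.swap) (simp add: raised_g sum_distrib_right)
  qed
  have 4: "(\<Sum>i\<in>UNIV. \<Sum>j\<in>UNIV. raised i j * (\<Sum>k\<in>UNIV. g i k * dX j k)) = q_dX"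
    unfolding 3[symmetric] by (subst sum.swap) (simp add: g_sym raised_sym)
  show ?thesis
    using 1 2 3 4 by (simp add: sum.distrib distrib_left)
qed

text \<open>div Y = X(t)/2 + \<sigma> t for Y^i = G^ik q_kj X^j. The assumption is the hypothesis
  on div q in coordinates. On the left is \<partial>_i Y^i with \<partial>G expressed through \<partial>g, together with
  Y^i times the logarithmic derivative of sqrt (det g). All terms containing \<partial>g cancel against the
  Christoffel terms of div q except for X^j q^km \<partial>_j g_km / 2, which \<open>raised_contraction\<close> combines
  with q^i_j \<partial>_i X^j to \<sigma> t.\<close>

lemma divergence_tensor_applied:
  assumes dt: "\<And>j. (\<Sum>i\<in>UNIV. \<Sum>k\<in>UNIV. G i k * (dq k i j - (\<Sum>l\<in>UNIV. chris l k i * q l j) 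
       - (\<Sum>l\<in>UNIV. chris l k j * q i l))) = dt j / 2"
  shows "(\<Sum>i\<in>UNIV. \<Sum>k\<in>UNIV. \<Sum>j\<in>UNIV.
        - (\<Sum>a\<in>UNIV. \<Sum>b\<in>UNIV. G i a * dg i a b * G b k) * q k j * X j + G i k * dq i k j * X j + G i k * q k j * dX i j)
     + (1/2) * (\<Sum>i\<in>UNIV. (\<Sum>k\<in>UNIV. \<Sum>j\<in>UNIV. G i k * q k j * X j) * (\<Sum>a\<in>UNIV. \<Sum>b\<in>UNIV. G a b * dg i a b))
     = (1/2) * (\<Sum>j\<in>UNIV. X j * dt j) + \<sigma> * tensor_tr"
proof -
  define P where "P j = (\<Sum>i\<in>UNIV. \<Sum>k\<in>UNIV. G i k * dq k i j)" for j
  have dt': "dt j / 2 = P j - (\<Sum>l\<in>UNIV. q l j * metric_div l) + (\<Sum>l\<in>UNIV. q l j * log_det_grad l) / 2 - raised_dot_dg j / 2" for j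
    using dt[of j] chris_term1[of j] chris_term2[of j]
    by (simp add: P_def right_diff_distrib sum_subtractf flip: sum_divide_distrib)
  have metric_div_alt: "(\<Sum>i\<in>UNIV. \<Sum>a\<in>UNIV. \<Sum>b\<in>UNIV. G i a * dg i a b * G b k) = metric_div k" for k
    unfolding metric_div_def by (subst sum.swap) (simp add: G_sym mult_ac)
  have 1: "(\<Sum>i\<in>UNIV. \<Sum>k\<in>UNIV. \<Sum>j\<in>UNIV. (\<Sum>a\<in>UNIV. \<Sum>b\<in>UNIV. G i a * dg i a b * G b k) * q k j * X j)
     = (\<Sum>j\<in>UNIV. X j * (\<Sum>l\<in>UNIV. q l j * metric_div l))"
  proof -
    have "(\<Sum>i\<in>UNIV. \<Sum>k\<in>UNIV. \<Sum>j\<in>UNIV. (\<Sum>a\<in>UNIV. \<Sum>b\<in>UNIV. G i a * dg i a b * G b k) * q k j * X j)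
      = (\<Sum>k\<in>UNIV. \<Sum>j\<in>UNIV. \<Sum>i\<in>UNIV. (\<Sum>a\<in>UNIV. \<Sum>b\<in>UNIV. G i a * dg i a b * G b k) * q k j * X j)"
      by (rule sum_rotate3[symmetric])
    also have "\<dots> = (\<Sum>k\<in>UNIV. \<Sum>j\<in>UNIV. metric_div k * q k j * X j)"
      by (simp add: metric_div_alt flip: sum_distrib_right)
    finally show ?thesis by (subst (asm) (2) sum.swap) (simp add: sum_distrib_left mult_ac)
  qed
  have 2: "(\<Sum>i\<in>UNIV. \<Sum>k\<in>UNIV. \<Sum>j\<in>UNIV. G i k * dq i k j * X j) = (\<Sum>j\<in>UNIV. X j * P j)"
  proof -
    have "(\<Sum>i\<in>UNIV. \<Sum>k\<in>UNIV. \<Sum>j\<in>UNIV. G i k * dq i k j * X j) = (\<Sum>j\<in>UNIV. \<Sum>i\<in>UNIV. \<Sum>k\<in>UNIV. G i k * dq i k j * X j)"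
      by (rule sum_rotate3)
    also have "\<dots> = (\<Sum>j\<in>UNIV. X j * P j)" unfolding P_def
      by (rule sum.cong[OF refl], subst sum.swap) (simp add: sum_distrib_left mult_ac G_sym)
    finally show ?thesis .
  qed
  have 3: "(\<Sum>i\<in>UNIV. (\<Sum>k\<in>UNIV. \<Sum>j\<in>UNIV. G i k * q k j * X j) * (\<Sum>a\<in>UNIV. \<Sum>b\<in>UNIV. G a b * dg i a b))
     = (\<Sum>j\<in>UNIV. X j * (\<Sum>l\<in>UNIV. q l j * log_det_grad l))"
  proof -
    define W where "W i = (\<Sum>a\<in>UNIV. \<Sum>b\<in>UNIV. G a b * dg i a b)" for i
    have log_det_grad: "log_det_grad k = (\<Sum>i\<in>UNIV. G k i * W i)" for k
      unfolding log_det_grad_def W_def by (subst sum_rotate3) (simp add: sum_distrib_left mult_ac dg_sym)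
    have "(\<Sum>i\<in>UNIV. (\<Sum>k\<in>UNIV. \<Sum>j\<in>UNIV. G i k * q k j * X j) * W i)
       = (\<Sum>i\<in>UNIV. \<Sum>k\<in>UNIV. \<Sum>j\<in>UNIV. G k i * W i * (q k j * X j))"
      by (simp add: sum_distrib_left sum_distrib_right mult_ac G_sym)
    also have "\<dots> = (\<Sum>k\<in>UNIV. \<Sum>j\<in>UNIV. \<Sum>i\<in>UNIV. G k i * W i * (q k j * X j))"
      by (rule sum_rotate3[symmetric])
    also have "\<dots> = (\<Sum>k\<in>UNIV. \<Sum>j\<in>UNIV. log_det_grad k * (q k j * X j))"
      by (simp only: log_det_grad sum_distrib_right)
    finally show ?thesis unfolding W_def[symmetric] by (subst (asm) (2) sum.swap) (simp add: sum_distrib_left mult_ac)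
  qed
  have "(\<Sum>j\<in>UNIV. X j * dt j) / 2 = (\<Sum>j\<in>UNIV. X j * (dt j / 2))" by (simp add: sum_divide_distrib)
  also have "\<dots> = (\<Sum>j\<in>UNIV. X j * P j) - (\<Sum>j\<in>UNIV. X j * (\<Sum>l\<in>UNIV. q l j * metric_div l))
     + (\<Sum>j\<in>UNIV. X j * (\<Sum>l\<in>UNIV. q l j * log_det_grad l)) / 2 - (\<Sum>j\<in>UNIV. X j * raised_dot_dg j) / 2"
    unfolding dt' by (simp add: distrib_left right_diff_distrib sum.distrib sum_subtractf flip: sum_divide_distrib)
  finally have 4: "(\<Sum>j\<in>UNIV. X j * dt j) / 2 = (\<Sum>j\<in>UNIV. X j * P j) - (\<Sum>j\<in>UNIV. X j * (\<Sum>l\<in>UNIV. q l j * metric_div l))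
     + (\<Sum>j\<in>UNIV. X j * (\<Sum>l\<in>UNIV. q l j * log_det_grad l)) / 2 - (\<Sum>j\<in>UNIV. X j * raised_dot_dg j) / 2" .
  have 5: "\<sigma> * tensor_tr = (\<Sum>j\<in>UNIV. X j * raised_dot_dg j) / 2 + q_dX" using raised_contraction by simp
  show ?thesis
    using 1 2 3 4 unfolding 5 q_dX_def by (simp add: sum.distrib sum_negf sum_subtractf field_simps)
qed

end

end

section \<open>Two facts on integrals over Euclidean space\<close>

text \<open>Difference quotients of f in direction i have integral zero because Lebesgue
  measure is invariant under translations. By the mean value theorem they are bounded uniformly, and
  their supports lie in a common ball, so dominated convergence carries this over to the derivative.\<close>

lemma has_bochner_integral_pd_compact_support:
  fixes f :: "real ^ 'n::finite \<Rightarrow> real"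
  assumes f: "C1_on UNIV f" and K: "compact K" and supp: "\<And>x. x \<notin> K \<Longrightarrow> f x = 0"
  shows "has_bochner_integral lborel (pd i f) 0"
proof -
  obtain r where r: "r > 0" "K \<subseteq> ball 0 r"
    using K compact_imp_bounded bounded_subset_ballD by metis
  let ?e = "axis i 1 :: real ^ 'n"
  have cf: "continuous_on UNIV f" and cpd: "continuous_on UNIV (pd i f)"
    using f C1_on_imp_continuous_on C1_on_continuous_pd by auto
  \<comment> \<open>The derivative is supported in K as well, so it is bounded.\<close>
  have pd0: "pd i f x = 0" if "x \<notin> K" for x
  proof -
    have "pd i f x = pd i (\<lambda>x. 0) x"
      by (rule derivative_local[of "- K"]) (use K that supp compact_imp_closed in auto)
    then show ?thesis by simp
  qed
  obtain B where B: "\<And>x. \<bar>pd i f x\<bar> \<le> B" "B \<ge> 0"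
  proof -
    have "bounded (pd i f ` K)"
      using K cpd by (intro compact_imp_bounded compact_continuous_image) (auto intro: continuous_on_subset)
    then obtain b where b: "\<And>x. x \<in> K \<Longrightarrow> \<bar>pd i f x\<bar> \<le> b" by (auto simp: bounded_iff)
    have "\<bar>pd i f x\<bar> \<le> max b 0" for x
      using b[of x] pd0[of x] by (cases "x \<in> K") auto
    then show ?thesis by (rule that) auto
  qed
  have der: "((\<lambda>t. f (x + t *\<^sub>R ?e)) has_real_derivative pd i f (x + t *\<^sub>R ?e)) (at t)" for x t
  proof -
    have 1: "((\<lambda>t. x + t *\<^sub>R ?e) has_derivative (\<lambda>h. h *\<^sub>R ?e)) (at t)"
      by (auto intro!: derivative_eq_intros)
    have "f differentiable (at (x + t *\<^sub>R ?e))" using f by (simp add: C1_on_def)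
    from has_derivative_compose[OF 1 has_derivative_pd[OF this]]
    have "((\<lambda>t. f (x + t *\<^sub>R ?e)) has_derivative (\<lambda>h. \<Sum>j\<in>UNIV. (h *\<^sub>R ?e) $ j * pd j f (x + t *\<^sub>R ?e))) (at t)" .
    also have "(\<lambda>h. \<Sum>j\<in>UNIV. (h *\<^sub>R ?e) $ j * pd j f (x + t *\<^sub>R ?e)) = (*) (pd i f (x + t *\<^sub>R ?e))"
      by (simp add: fun_eq_iff axis_def mult.assoc if_distrib[of "\<lambda>y. y * _"] flip: sum_distrib_left cong: if_cong)
    finally show ?thesis by (simp add: has_field_derivative_def)
  qed
  \<comment> \<open>The step sizes 1, 1/2, 1/3, ... keep all supports inside the ball of radius r + 1.\<close>
  define h where "h n = inverse (real (Suc n))" for n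
  have h: "0 < h n" "h n \<le> 1" for n by (auto simp: h_def field_simps)
  define F where "F n x = (f (x + h n *\<^sub>R ?e) - f x) / h n" for n x
  have lim: "(\<lambda>n. F n x) \<longlonglongrightarrow> pd i f x" for x
  proof -
    have "((\<lambda>t. (f (x + t *\<^sub>R ?e) - f x) / t) \<longlongrightarrow> pd i f x) (at 0)"
      using der[of x 0] by (simp add: has_field_derivative_iff)
    moreover have "filterlim h (at 0) sequentially"
      unfolding h_def using LIMSEQ_inverse_real_of_nat by (intro filterlim_atI) auto
    ultimately show ?thesis unfolding F_def by (rule filterlim_compose)
  qed
  have bound: "\<bar>F n x\<bar> \<le> indicator (cball 0 (r+1)) x * B" for n x
  proof (cases "x \<in> cball 0 (r + 1)")
    case True
    obtain z where "f (x + h n *\<^sub>R ?e) - f (x + 0 *\<^sub>R ?e) = (h n - 0) * pd i f (x + z *\<^sub>R ?e)"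
      using MVT2[of 0 "h n" "\<lambda>t. f (x + t *\<^sub>R ?e)" "\<lambda>t. pd i f (x + t *\<^sub>R ?e)"] h der by blast
    then have "F n x = pd i f (x + z *\<^sub>R ?e)" unfolding F_def using h(1)[of n] by simp
    then show ?thesis using B True by simp
  next
    case False
    have "norm x \<le> norm (x + h n *\<^sub>R ?e) + norm (h n *\<^sub>R ?e)"
      by (metis add_diff_cancel_right' norm_triangle_ineq4)
    also have "norm (h n *\<^sub>R ?e) \<le> 1" using h[of n] by simp
    finally have "x + h n *\<^sub>R ?e \<notin> K" "x \<notin> K" using False r by auto
    then show ?thesis using supp False by (simp add: F_def)
  qed
  have f_int: "integrable lborel f"
  proof -
    have "integrable lborel (\<lambda>x. indicator K x *\<^sub>R f x)"
      using K cf by (intro borel_integrable_compact) (auto intro: continuous_on_subset)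
    moreover have "(\<lambda>x. indicator K x *\<^sub>R f x) = f" using supp by (auto simp: indicator_def fun_eq_iff)
    ultimately show ?thesis by simp
  qed
  have f_meas: "f \<in> borel_measurable borel" using cf by (rule borel_measurable_continuous_onI)
  have shift: "integrable lborel (\<lambda>x. f (x + c))" "(\<integral>x. f (x + c) \<partial>lborel) = (\<integral>x. f x \<partial>lborel)" for c
  proof -
    have "integrable (distr lborel borel ((+) c)) f" using f_int by (simp add: lborel_distr_plus)
    then show "integrable lborel (\<lambda>x. f (x + c))"
      by (subst (asm) integrable_distr_eq) (use f_meas in \<open>auto simp: add.commute\<close>)
    have "(\<integral>x. f x \<partial>lborel) = (\<integral>x. f x \<partial>(distr lborel borel ((+) c)))" by (simp add: lborel_distr_plus)
    also have "\<dots> = (\<integral>x. f (c + x) \<partial>lborel)"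
      by (subst integral_distr) (use f_meas in auto)
    finally show "(\<integral>x. f (x + c) \<partial>lborel) = (\<integral>x. f x \<partial>lborel)" by (simp add: add.commute)
  qed
  have F_int: "(\<integral>x. F n x \<partial>lborel) = 0" for n
    unfolding F_def using shift f_int by simp
  have pd_meas: "pd i f \<in> borel_measurable lborel" using cpd borel_measurable_continuous_onI by simp
  have F_meas: "F n \<in> borel_measurable lborel" for n
    unfolding F_def using f_meas by measurable
  have dom: "integrable lborel (\<lambda>x :: real ^ 'n. indicator (cball 0 (r+1)) x * B :: real)"
    using borel_integrable_compact[of "cball (0::real^'n) (r+1)" "\<lambda>x. B"] by simp
  have "integrable lborel (pd i f)"
    by (rule integrable_dominated_convergence[where s = F, OF pd_meas F_meas dom]) (use lim bound in auto)
  moreover have "(\<lambda>n. \<integral>x. F n x \<partial>lborel) \<longlonglongrightarrow> (\<integral>x. pd i f x \<partial>lborel)"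
    by (rule integral_dominated_convergence[where s = F, OF pd_meas F_meas dom]) (use lim bound in auto)
  then have "(\<integral>x. pd i f x \<partial>lborel) = 0"
    by (simp add: F_int LIMSEQ_const_iff)
  ultimately show ?thesis by (simp add: has_bochner_integral_iff)
qed

text \<open>A bridge from integrals of nonnegative functions with values in the extended
  reals to absolute integrability, for which the change of variables theorem is formulated.\<close>

lemma nn_integral_eq_integral_or_top:
  fixes h :: "real ^ 'n::finite \<Rightarrow> real"
  assumes m: "(\<lambda>x. indicator S x *\<^sub>R h x) \<in> borel_measurable borel" and pos: "\<And>x. x \<in> S \<Longrightarrow> 0 \<le> h x"
  shows "(\<integral>\<^sup>+x. ennreal (h x) * indicator S x \<partial>lborel) =
    (if h absolutely_integrable_on S then ennreal (integral S h) else \<infinity>)"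
proof -
  let ?h = "\<lambda>x. indicator S x *\<^sub>R h x"
  have eq: "(\<integral>\<^sup>+x. ennreal (h x) * indicator S x \<partial>lborel) = (\<integral>\<^sup>+x. ennreal (?h x) \<partial>lborel)"
    by (intro nn_integral_cong) (auto simp: indicator_def)
  have h0: "0 \<le> ?h x" for x using pos by (auto simp: indicator_def)
  have ai: "h absolutely_integrable_on S \<longleftrightarrow> integrable lborel ?h"
    unfolding set_integrable_def using m by (simp add: integrable_completion)
  show ?thesis
  proof (cases "h absolutely_integrable_on S")
    case True
    then have "(\<integral>\<^sup>+x. ennreal (?h x) \<partial>lborel) = ennreal (\<integral>x. ?h x \<partial>lborel)"
      using ai h0 by (intro nn_integral_eq_integral) auto
    also have "(\<integral>x. ?h x \<partial>lborel) = (\<integral>x. ?h x \<partial>lebesgue)"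
      using m by (simp add: integral_completion)
    also have "\<dots> = integral S h"
      using set_lebesgue_integral_eq_integral(2)[OF True] by (simp add: set_lebesgue_integral_def)
    finally show ?thesis using True eq by simp
  next
    case False
    then have "\<not> (\<integral>\<^sup>+x. ennreal (?h x) \<partial>lborel) < \<infinity>"
      using ai m h0 by (auto simp: integrable_iff_bounded)
    then have "(\<integral>\<^sup>+x. ennreal (?h x) \<partial>lborel) = \<infinity>"
      by (metis infinity_ennreal_def top.not_eq_extremum)
    then show ?thesis using False eq by simp
  qed
qed

text \<open>The volume of a chart is not known to be finite in advance, so the
  formula is needed with the value infinity allowed on both sides.\<close>

lemma nn_integral_change_of_variables:
  fixes \<phi> :: "real ^ 'n::{finite,wellorder} \<Rightarrow> real ^ 'n::_" and f :: "real ^ 'n::_ \<Rightarrow> real"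
  assumes B: "B \<in> sets borel" and der: "\<And>x. x \<in> B \<Longrightarrow> (\<phi> has_derivative \<phi>' x) (at x)" and inj: "inj_on \<phi> B"
    and m1: "(\<lambda>y. indicator (\<phi> ` B) y *\<^sub>R f y) \<in> borel_measurable borel"
    and m2: "(\<lambda>x. indicator B x *\<^sub>R (\<bar>det (matrix (\<phi>' x))\<bar> * f (\<phi> x))) \<in> borel_measurable borel"
    and pos: "\<And>x. x \<in> B \<Longrightarrow> 0 \<le> f (\<phi> x)"
  shows "(\<integral>\<^sup>+y. ennreal (f y) * indicator (\<phi> ` B) y \<partial>lborel) =
    (\<integral>\<^sup>+x. ennreal (\<bar>det (matrix (\<phi>' x))\<bar> * f (\<phi> x)) * indicator B x \<partial>lborel)"
proof -
  let ?D = "\<lambda>x. \<bar>det (matrix (\<phi>' x))\<bar> * f (\<phi> x)"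
  have L: "B \<in> sets lebesgue" using B by simp
  have "?D absolutely_integrable_on B \<and> integral B ?D = b \<longleftrightarrow>
      f absolutely_integrable_on (\<phi> ` B) \<and> integral (\<phi> ` B) f = b" for b
    using has_absolute_integral_change_of_variables[OF L has_derivative_at_withinI[OF der] inj,
        of "\<lambda>y. vec (f y) :: real ^ 1" "vec b"]
    unfolding absolutely_integrable_on_1_iff integral_on_1_eq by (simp add: vec_eq_iff)
  then have iff: "?D absolutely_integrable_on B \<longleftrightarrow> f absolutely_integrable_on (\<phi> ` B)"
    and eq: "?D absolutely_integrable_on B \<Longrightarrow> integral B ?D = integral (\<phi> ` B) f"
    by blast+
  have "(\<integral>\<^sup>+y. ennreal (f y) * indicator (\<phi> ` B) y \<partial>lborel) =
    (if f absolutely_integrable_on (\<phi> ` B) then ennreal (integral (\<phi> ` B) f) else \<infinity>)"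
    by (rule nn_integral_eq_integral_or_top[OF m1]) (use pos in auto)
  moreover have "(\<integral>\<^sup>+x. ennreal (?D x) * indicator B x \<partial>lborel) =
    (if ?D absolutely_integrable_on B then ennreal (integral B ?D) else \<infinity>)"
    by (rule nn_integral_eq_integral_or_top[OF m2]) (use pos in auto)
  ultimately show ?thesis using iff eq by simp
qed

section \<open>Charts, changes of coordinates and invariant expressions\<close>

context smooth_manifold
begin

lemma cdom_subset: "c \<in> A \<Longrightarrow> cdom c \<subseteq> topspace T"
  by (rule openin_subset[OF open_dom])

lemma inj_on_cmap: "c \<in> A \<Longrightarrow> inj_on (cmap c) (cdom c)"
  using homeomorphic_imp_injective_map[OF homeo, of c] cdom_subset[of c]
  by (simp add: topspace_subtopology Int_absorb1)

lemma cinv_cmap: "c \<in> A \<Longrightarrow> p \<in> cdom c \<Longrightarrow> cinv c (cmap c p) = p"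
  unfolding cinv_def by (rule inv_into_f_f[OF inj_on_cmap])

lemma cmap_cinv: "x \<in> crange c \<Longrightarrow> cmap c (cinv c x) = x"
  unfolding cinv_def crange_def by (rule f_inv_into_f)

lemma cinv_in: "x \<in> crange c \<Longrightarrow> cinv c x \<in> cdom c"
  unfolding cinv_def crange_def by (rule inv_into_into)

lemma cmap_in: "p \<in> cdom c \<Longrightarrow> cmap c p \<in> crange c"
  unfolding crange_def by simp

lemma cmap_image_eq:
  assumes "c \<in> A" "B \<subseteq> cdom c" shows "cmap c ` B = {x \<in> crange c. cinv c x \<in> B}"
proof safe
  fix p assume "p \<in> B"
  then show "cmap c p \<in> crange c" "cinv c (cmap c p) \<in> B" using assms cmap_in[of p c] cinv_cmap[of c p] by (auto simp: subset_iff)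
next
  fix x assume "x \<in> crange c" "cinv c x \<in> B"
  then show "x \<in> cmap c ` B" using cmap_cinv by (metis imageI)
qed

lemma open_cmap_image:
  assumes "c \<in> A" "openin T U" "U \<subseteq> cdom c"
  shows "open (cmap c ` U)"
proof -
  have "openin (subtopology T (cdom c)) U"
    using assms by (simp add: openin_open_subtopology open_dom)
  then have "openin (top_of_set (crange c)) (cmap c ` U)"
    using homeomorphic_imp_open_map[OF homeo[OF assms(1)]] unfolding open_map_def by blast
  then show ?thesis using open_range[OF assms(1)] by (metis openin_open_eq)
qed

lemma openin_cmap_vimage:
  assumes "c \<in> A" "open V"
  shows "openin T {p \<in> cdom c. cmap c p \<in> V}"
proof -
  have "openin (top_of_set (crange c)) (crange c \<inter> V)" using assms(2) by (simp add: openin_open_Int)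
  then have "openin (subtopology T (cdom c)) {p \<in> topspace (subtopology T (cdom c)). cmap c p \<in> crange c \<inter> V}"
    using homeomorphic_imp_continuous_map[OF homeo[OF assms(1)]] openin_continuous_map_preimage by blast
  moreover have "{p \<in> topspace (subtopology T (cdom c)). cmap c p \<in> crange c \<inter> V} = {p \<in> cdom c. cmap c p \<in> V}"
    using cdom_subset[OF assms(1)] cmap_in[of _ c] by auto
  ultimately show ?thesis using open_dom[OF assms(1)] by (simp add: openin_open_subtopology)
qed

lemma chart_at:
  assumes "p \<in> topspace T"
  shows "chart_at A p \<in> A" "p \<in> cdom (chart_at A p)"
proof -
  have "\<exists>c. c \<in> A \<and> p \<in> cdom c" using assms covers by blast
  then have "chart_at A p \<in> A \<and> p \<in> cdom (chart_at A p)" unfolding chart_at_def by (rule someI_ex)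
  then show "chart_at A p \<in> A" "p \<in> cdom (chart_at A p)" by auto
qed

definition overlap where "overlap c d = cmap c ` (cdom c \<inter> cdom d)"

lemma open_overlap: "c \<in> A \<Longrightarrow> d \<in> A \<Longrightarrow> open (overlap c d)"
  unfolding overlap_def by (intro open_cmap_image) (auto intro: open_dom)

lemma overlapI: "p \<in> cdom c \<Longrightarrow> p \<in> cdom d \<Longrightarrow> cmap c p \<in> overlap c d"
  unfolding overlap_def by simp

lemma overlapE:
  assumes "c \<in> A" "x \<in> overlap c d" obtains "x \<in> crange c" "cinv c x \<in> cdom c" "cinv c x \<in> cdom d"
  using assms unfolding overlap_def by (auto simp: cinv_cmap cmap_in)

lemma change_differentiable:
  assumes "c \<in> A" "d \<in> A" "x \<in> overlap c d"
  shows "(\<lambda>x. cmap d (cinv c x)) differentiable (at x)"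
  using smooth_on_C1_components(1)[OF compatible[OF assms(1,2)]] assms(3)
  unfolding overlap_def by (simp add: comp_def)

lemma change_C1:
  assumes "c \<in> A" "d \<in> A"
  shows "C1_on (overlap c d) (\<lambda>x. cmap d (cinv c x) $ i)"
  using smooth_on_C1_components(2)[OF compatible[OF assms(1,2)]]
  unfolding overlap_def by (simp add: comp_def)

lemma transition_nth:
  assumes "c \<in> A" "d \<in> A" "p \<in> cdom c" "p \<in> cdom d"
  shows "transition c d p $ i $ j = pd j (\<lambda>x. cmap d (cinv c x) $ i) (cmap c p)"
proof -
  have "(cmap d \<circ> cinv c) differentiable (at (cmap c p))"
    using change_differentiable[OF assms(1,2) overlapI[OF assms(3,4)]] by (simp add: comp_def)
  then have "((cmap d \<circ> cinv c) has_derivative (\<lambda>h. transition c d p *v h)) (at (cmap c p))"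
    unfolding transition_def by (simp add: jacobian_works)
  from pd_vec_nth(2)[OF this, of j i] show ?thesis
    by (simp add: comp_def matrix_vector_mul_component inner_axis)
qed

lemma compose_change:
  assumes "c \<in> A" "d \<in> A" "p \<in> cdom c" "p \<in> cdom d" and f: "(f \<circ> cinv d) differentiable (at (cmap d p))"
  shows "(f \<circ> cinv c) differentiable (at (cmap c p))"
    and "partial c i f p = (\<Sum>j\<in>UNIV. transition c d p $ j $ i * partial d j f p)"
proof -
  let ?\<phi> = "\<lambda>x. cmap d (cinv c x)"
  have x: "cmap c p \<in> overlap c d" using assms by (simp add: overlapI)
  have eq: "(f \<circ> cinv c) y = (f \<circ> cinv d) (?\<phi> y)" if "y \<in> overlap c d" for y
    using overlapE[OF assms(1) that] cinv_cmap[OF assms(2)] by (metis comp_apply)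
  have f': "(f \<circ> cinv d) differentiable (at (?\<phi> (cmap c p)))"
    using f assms by (simp add: cinv_cmap)
  note tr = derivative_local[where f = "f \<circ> cinv c" and g = "\<lambda>x. (f \<circ> cinv d) (?\<phi> x)",
      OF open_overlap[OF assms(1,2)] x eq]
  note pc = pd_compose[of "f \<circ> cinv d" ?\<phi>, OF f' change_differentiable[OF assms(1,2) x]]
  show "(f \<circ> cinv c) differentiable (at (cmap c p))" using tr(1) pc(1) by blast
  show "partial c i f p = (\<Sum>j\<in>UNIV. transition c d p $ j $ i * partial d j f p)"
    using trans[OF tr(2) pc(2), of i] assms
    by (simp add: partial_eq_pd transition_nth cinv_cmap)
qed

text \<open>The chain rule applied to a coordinate of the first chart, read as a function on the
  manifold and expressed in the second chart.\<close>

lemma transition_inverse: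
  assumes "c \<in> A" "d \<in> A" "p \<in> cdom c" "p \<in> cdom d"
  shows "transition d c p ** transition c d p = mat 1"
proof -
  have "(transition d c p ** transition c d p) $ i $ j = mat 1 $ i $ j" for i j
  proof -
    let ?f = "\<lambda>p. cmap c p $ i"
    have "(?f \<circ> cinv d) differentiable (at (cmap d p))"
      using C1_on_differentiable[OF change_C1[OF assms(2,1)] overlapI[OF assms(4,3)]] by (simp add: comp_def)
    from compose_change(2)[OF assms this, of j]
    have "partial c j ?f p = (\<Sum>k\<in>UNIV. transition c d p $ k $ j * partial d k ?f p)" .
    also have "\<dots> = (\<Sum>k\<in>UNIV. transition d c p $ i $ k * transition c d p $ k $ j)"
      using assms by (simp add: partial_eq_pd transition_nth comp_def mult.commute)
    also have "partial c j ?f p = pd j (\<lambda>x. x $ i) (cmap c p)"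
      unfolding partial_eq_pd
      by (rule derivative_local[OF open_range[OF assms(1)]]) (use assms in \<open>auto simp: cmap_in cmap_cinv\<close>)
    also have "\<dots> = mat 1 $ i $ j"
      by (subst pd_eq[OF bounded_linear_imp_has_derivative[OF bounded_linear_vec_nth]]) (simp add: axis_def mat_def)
    finally show ?thesis by (simp add: matrix_mult_nth)
  qed
  then show ?thesis by (simp add: vec_eq_iff)
qed

definition C1_fun :: "('a \<Rightarrow> real) \<Rightarrow> bool" where
  "C1_fun f \<longleftrightarrow> (\<forall>c\<in>A. C1_on (crange c) (f \<circ> cinv c))"

lemma C1_fun_differentiable:
  "C1_fun f \<Longrightarrow> c \<in> A \<Longrightarrow> p \<in> cdom c \<Longrightarrow> (f \<circ> cinv c) differentiable (at (cmap c p))"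
  unfolding C1_fun_def using C1_on_differentiable[of "crange c"] cmap_in[of p c] by metis

text \<open>The transformation law of a vector field without its smoothness: the fields built
  below are treated as fields of class C^1, so smoothness is stated separately.\<close>

definition transforms_as_vector :: "('a, 'n) vfield \<Rightarrow> bool" where
  "transforms_as_vector W \<longleftrightarrow>
    (\<forall>c\<in>A. \<forall>d\<in>A. \<forall>p\<in>cdom c \<inter> cdom d. W d p = transition c d p *v W c p)"

text \<open>The components of a vector field transform with the Jacobian and the partial
  derivatives of a function with its transpose, so the pairing does not depend on the chart.\<close>

lemma directional_derivative_invariant:
  assumes W: "transforms_as_vector W" and f: "C1_fun f"
    and c: "c \<in> A" "p \<in> cdom c" and d: "d \<in> A" "p \<in> cdom d"
  shows "(\<Sum>k\<in>UNIV. W c p $ k * partial c k f p) = (\<Sum>k\<in>UNIV. W d p $ k * partial d k f p)"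
proof -
  have "(\<Sum>k\<in>UNIV. W c p $ k * partial c k f p) =
      (\<Sum>k\<in>UNIV. \<Sum>j\<in>UNIV. W c p $ k * (transition c d p $ j $ k * partial d j f p))"
    by (simp add: compose_change(2)[OF c(1) d(1) c(2) d(2) C1_fun_differentiable[OF f d]] sum_distrib_left)
  also have "\<dots> = (\<Sum>j\<in>UNIV. (\<Sum>k\<in>UNIV. transition c d p $ j $ k * W c p $ k) * partial d j f p)"
    by (subst sum.swap) (simp add: sum_distrib_right sum_distrib_left mult_ac)
  also have "\<dots> = (\<Sum>j\<in>UNIV. W d p $ j * partial d j f p)"
    using W c d by (simp add: transforms_as_vector_def matrix_vector_mult_def)
  finally show ?thesis .
qed

lemma lie_fun_eq:
  assumes "transforms_as_vector W" "C1_fun f" "c \<in> A" "p \<in> cdom c"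
  shows "lie_fun A W f p = (\<Sum>k\<in>UNIV. W c p $ k * partial c k f p)"
proof -
  have "p \<in> topspace T" using assms cdom_subset by blast
  then show ?thesis unfolding lie_fun_def Let_def
    by (intro directional_derivative_invariant assms chart_at)
qed

end

text \<open>Positive definite matrices form a convex set that contains the identity, and the
  determinant cannot vanish on it. By the intermediate value theorem it keeps its sign along the
  segment from the identity to M.\<close>

lemma det_pos_if_positive_definite:
  fixes M :: "real ^ 'n ^ 'n"
  assumes pos: "\<And>v. v \<noteq> 0 \<Longrightarrow> v \<bullet> (M *v v) > 0"
  shows "det M > 0"
proof (rule ccontr)
  assume "\<not> det M > 0"
  define H :: "real \<Rightarrow> real ^ 'n ^ 'n" where "H t = (1 - t) *\<^sub>R mat 1 + t *\<^sub>R M" for t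
  have "continuous_on {0..1} (\<lambda>t. det (H t))"
    unfolding det_def H_def by (intro continuous_intros)
  moreover have "det (H 1) \<le> 0" "0 \<le> det (H 0)" using \<open>\<not> det M > 0\<close> by (auto simp: H_def)
  ultimately obtain t where t: "0 \<le> t" "t \<le> 1" "det (H t) = 0"
    using IVT2'[of "\<lambda>t. det (H t)" 1 0 0] by auto
  then obtain v where v: "v \<noteq> 0" "H t *v v = 0"
    by (metis invertible_det_nz invertible_left_inverse matrix_left_invertible_ker)
  have "H t *v v = (1 - t) *\<^sub>R v + t *\<^sub>R (M *v v)"
    by (simp add: H_def matrix_vector_mult_add_rdistrib scaleR_matrix_vector_assoc[symmetric])
  then have "0 = (1 - t) * (v \<bullet> v) + t * (v \<bullet> (M *v v))"
    using v(2) by (metis inner_add_right inner_scaleR_right inner_zero_right)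
  moreover have "v \<bullet> v > 0" "v \<bullet> (M *v v) > 0" using v(1) pos by auto
  ultimately show False using t(1,2)
    by (smt (verit) mult_nonneg_nonneg mult_pos_pos)
qed

context riemannian_manifold
begin

lemma det_metric_pos: "c \<in> A \<Longrightarrow> p \<in> cdom c \<Longrightarrow> det (g c p) > 0"
  by (rule det_pos_if_positive_definite[OF metric_pos])

lemma tensor_change:
  assumes "tensor_field02 A q" "c \<in> A" "p \<in> cdom c" "d \<in> A" "p \<in> cdom d"
  shows "q c p = transpose (transition c d p) ** q d p ** transition c d p"
  using assms unfolding tensor_field02_def by blast

lemma metric_tensor_field: "tensor_field02 A g"
  using metric_tensor unfolding symmetric_tensor_field02_def by simp

lemma matrix_inv_metric_change:
  assumes "c \<in> A" "p \<in> cdom c" "d \<in> A" "p \<in> cdom d"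
  shows "transition c d p ** matrix_inv (g c p) ** transpose (transition c d p) = matrix_inv (g d p)"
proof -
  let ?J = "transition c d p" and ?I = "transition d c p"
  let ?G = "matrix_inv (g c p)"
  have IJ: "?I ** ?J = mat 1" and JI: "?J ** ?I = mat 1" 
    using assms by (auto intro: transition_inverse)
  have gd: "g d p = transpose ?I ** g c p ** ?I"
    by (rule tensor_change[OF metric_tensor_field assms(3,4,1,2)])
  have "g d p ** (?J ** ?G ** transpose ?J) = transpose ?I ** (g c p ** (?I ** ?J) ** ?G) ** transpose ?J"
    unfolding gd by (simp add: matrix_mul_assoc)
  also have "\<dots> = transpose ?I ** transpose ?J"
    using IJ matrix_inv_mult(1)[of "g c p"] det_metric_pos[OF assms(1,2)] by simp
  also have "\<dots> = transpose (?J ** ?I)" by (simp add: matrix_transpose_mul)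
  also have "\<dots> = mat 1" using JI by (simp add: transpose_mat)
  finally show ?thesis by (rule matrix_inv_unique[symmetric])
qed

lemma symmetric_metric: "c \<in> A \<Longrightarrow> p \<in> cdom c \<Longrightarrow> transpose (g c p) = g c p"
  using metric_tensor unfolding symmetric_tensor_field02_def by simp

text \<open>The trace may be computed in any chart: it is the trace of the matrix g^-1 q, and a change
  of coordinates conjugates this matrix.\<close>

lemma metric_trace_eq:
  assumes q: "tensor_field02 A q" and c: "c \<in> A" "p \<in> cdom c"
  shows "metric_trace A g q p = (\<Sum>i\<in>UNIV. \<Sum>j\<in>UNIV. matrix_inv (g c p) $ i $ j * q c p $ i $ j)"
proof -
  have tr: "(\<Sum>i\<in>UNIV. \<Sum>j\<in>UNIV. matrix_inv (g c p) $ i $ j * q c p $ i $ j) = trace (matrix_inv (g c p) ** q c p)"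
    if c: "c \<in> A" "p \<in> cdom c" for c
  proof -
    have sym: "transpose (matrix_inv (g c p)) = matrix_inv (g c p)"
      using det_metric_pos[OF c] symmetric_metric[OF c] by (simp add: transpose_matrix_inv)
    have "(\<Sum>i\<in>UNIV. \<Sum>j\<in>UNIV. matrix_inv (g c p) $ i $ j * q c p $ i $ j)
        = trace (transpose (matrix_inv (g c p)) ** q c p)"
      unfolding trace_def matrix_mult_nth transpose_def vec_lambda_beta by (rule sum.swap)
    then show ?thesis by (simp add: sym)
  qed
  let ?d = "chart_at A p"
  have d: "?d \<in> A" "p \<in> cdom ?d" using chart_at c cdom_subset by blast+
  let ?J = "transition c ?d p"
  have "trace (matrix_inv (g ?d p) ** q ?d p) = trace (?J ** (matrix_inv (g c p) ** transpose ?J ** q ?d p))"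
    by (simp add: matrix_inv_metric_change[OF c d, symmetric] matrix_mul_assoc)
  also have "\<dots> = trace (matrix_inv (g c p) ** transpose ?J ** q ?d p ** ?J)" by (rule trace_mul_sym)
  also have "\<dots> = trace (matrix_inv (g c p) ** q c p)"
    by (simp add: tensor_change[OF q c d] matrix_mul_assoc)
  finally show ?thesis unfolding metric_trace_def Let_def tr[OF c] tr[OF d] .
qed

end

section \<open>The Riemannian volume measure\<close>

context riemannian_manifold
begin

definition vol_density :: "('a, 'n) chart \<Rightarrow> real ^ 'n::_ \<Rightarrow> real" where
  "vol_density c x = sqrt (det (g c (cinv c x)))"

lemma tensor_entries_C1:
  assumes "tensor_field02 A q" "c \<in> A"
  shows "C1_on (crange c) (\<lambda>x. q c (cinv c x) $ i $ j)"
  using smooth_on_C1_entries[of "crange c" "q c \<circ> cinv c"] assms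
  unfolding tensor_field02_def by (simp add: comp_def)

lemma det_metric_C1: "c \<in> A \<Longrightarrow> C1_on (crange c) (\<lambda>x. det (g c (cinv c x)))"
  by (intro C1_on_det tensor_entries_C1 metric_tensor_field)

lemma vol_density_C1: "c \<in> A \<Longrightarrow> C1_on (crange c) (vol_density c)"
  unfolding vol_density_def[abs_def] by (intro C1_on_sqrt det_metric_C1 det_metric_pos cinv_in)

lemma vol_density_pos: "c \<in> A \<Longrightarrow> x \<in> crange c \<Longrightarrow> vol_density c x > 0"
  unfolding vol_density_def by (simp add: det_metric_pos cinv_in)

lemma vol_density_nonneg: "c \<in> A \<Longrightarrow> x \<in> crange c \<Longrightarrow> vol_density c x \<ge> 0"
  using vol_density_pos less_imp_le by blast

lemma vol_density_change:
  assumes "c \<in> A" "p \<in> cdom c" "d \<in> A" "p \<in> cdom d"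
  shows "vol_density c (cmap c p) = \<bar>det (transition c d p)\<bar> * vol_density d (cmap d p)"
proof -
  have "det (g c p) = (det (transition c d p))\<^sup>2 * det (g d p)"
    by (subst tensor_change[OF metric_tensor_field assms]) (simp add: det_mul power2_eq_square)
  then show ?thesis unfolding vol_density_def using assms by (simp add: cinv_cmap real_sqrt_mult)
qed

definition borel_sigma :: "'a measure" where "borel_sigma = sigma (topspace T) {U. openin T U}"

lemma opens_subset: "{U. openin T U} \<subseteq> Pow (topspace T)"
  using openin_subset by blast

lemma space_borel_sigma: "space borel_sigma = topspace T"
  unfolding borel_sigma_def using opens_subset by (rule space_measure_of)

lemma sets_borel_sigma: "sets borel_sigma = sigma_sets (topspace T) {U. openin T U}"
  unfolding borel_sigma_def using opens_subset by (rule sets_measure_of)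

lemma openin_sets_borel_sigma: "openin T U \<Longrightarrow> U \<in> sets borel_sigma"
  unfolding sets_borel_sigma by (simp add: sigma_sets.Basic)

lemma cdom_sets_borel_sigma: "c \<in> A \<Longrightarrow> cdom c \<in> sets borel_sigma"
  by (intro openin_sets_borel_sigma open_dom)

lemma sets_restrict_crange:
  "c \<in> A \<Longrightarrow> B \<in> sets (restrict_space lborel (crange c)) \<longleftrightarrow> B \<subseteq> crange c \<and> B \<in> sets borel"
  by (subst sets_restrict_space_iff) (auto intro!: borel_open open_range)

text \<open>Stated for the inverse of the coordinate map because the volume of a chart is an image
  measure under this map; it also shows that coordinate maps send Borel sets to Borel sets.\<close>

lemma cinv_measurable:
  assumes c: "c \<in> A"
  shows "cinv c \<in> measurable (restrict_space lborel (crange c)) borel_sigma"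
  unfolding borel_sigma_def
proof (rule measurable_measure_of[OF opens_subset])
  show "cinv c \<in> space (restrict_space lborel (crange c)) \<rightarrow> topspace T"
    using cinv_in[of _ c] cdom_subset[OF c] by (auto simp: space_restrict_space)
next
  fix U assume U: "U \<in> {U. openin T U}"
  have "cinv c -` U \<inter> space (restrict_space lborel (crange c)) = cmap c ` (U \<inter> cdom c)"
    using cinv_in[of _ c] by (auto simp: space_restrict_space cmap_image_eq[OF c])
  moreover have "open (cmap c ` (U \<inter> cdom c))"
    using U c by (intro open_cmap_image) (auto intro: open_dom)
  ultimately show "cinv c -` U \<inter> space (restrict_space lborel (crange c)) \<in> sets (restrict_space lborel (crange c))"
    unfolding sets_restrict_crange[OF c] by (auto simp: space_restrict_space)
qed

lemma cmap_image_sets: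
  assumes c: "c \<in> A" and B: "B \<in> sets borel_sigma" "B \<subseteq> cdom c"
  shows "cmap c ` B \<in> sets borel"
proof -
  have "cinv c -` B \<inter> space (restrict_space lborel (crange c)) \<in> sets (restrict_space lborel (crange c))"
    using cinv_measurable[OF c] B(1) by (rule measurable_sets)
  moreover have "cinv c -` B \<inter> space (restrict_space lborel (crange c)) = cmap c ` B"
    by (auto simp: space_restrict_space cmap_image_eq[OF c B(2)])
  ultimately show ?thesis by (simp add: sets_restrict_crange[OF c])
qed

text \<open>The Riemannian volume of the domain of c, extended by zero to all Borel sets of the
  manifold.\<close>

definition chart_volume :: "('a, 'n) chart \<Rightarrow> 'a measure" where
  "chart_volume c = distr (density (restrict_space lborel (crange c)) (\<lambda>x. ennreal (vol_density c x))) borel_sigma (cinv c)"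

lemma sets_chart_volume [simp]: "sets (chart_volume c) = sets borel_sigma"
  unfolding chart_volume_def by simp

lemma vol_density_measurable:
  assumes c: "c \<in> A" shows "vol_density c \<in> borel_measurable (restrict_space lborel (crange c))"
proof -
  have "vol_density c \<in> borel_measurable (restrict_space borel (crange c))"
    by (intro borel_measurable_continuous_on_restrict C1_on_imp_continuous_on vol_density_C1 c)
  then show ?thesis
    by (simp cong: measurable_cong_sets add: measurable_cong_sets[OF sets_restrict_space_cong[OF sets_lborel] refl])
qed

lemma emeasure_chart_volume:
  assumes c: "c \<in> A" and B: "B \<in> sets borel_sigma"
  shows "emeasure (chart_volume c) B = (\<integral>\<^sup>+x. ennreal (vol_density c x) * indicator (cmap c ` (B \<inter> cdom c)) x \<partial>lborel)"
proof -
  let ?R = "restrict_space lborel (crange c)"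
  have BR: "cinv c -` B \<inter> space ?R = cmap c ` (B \<inter> cdom c)"
    using cinv_in[of _ c] by (auto simp: space_restrict_space cmap_image_eq[OF c])
  have BS: "cmap c ` (B \<inter> cdom c) \<in> sets ?R"
    using measurable_sets[OF cinv_measurable[OF c] B] BR by simp
  have cm: "cinv c \<in> measurable (density ?R (\<lambda>x. ennreal (vol_density c x))) borel_sigma"
    using cinv_measurable[OF c] by simp
  have "emeasure (chart_volume c) B = emeasure (density ?R (\<lambda>x. ennreal (vol_density c x))) (cmap c ` (B \<inter> cdom c))"
    unfolding chart_volume_def by (subst emeasure_distr[OF cm B]) (simp add: BR)
  also have "\<dots> = (\<integral>\<^sup>+x. ennreal (vol_density c x) * indicator (cmap c ` (B \<inter> cdom c)) x \<partial>?R)"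
    using BS vol_density_measurable[OF c] by (intro emeasure_density) auto
  also have "\<dots> = (\<integral>\<^sup>+x. ennreal (vol_density c x) * indicator (cmap c ` (B \<inter> cdom c)) x * indicator (crange c) x \<partial>lborel)"
    using open_range[OF c] by (intro nn_integral_restrict_space) auto
  also have "\<dots> = (\<integral>\<^sup>+x. ennreal (vol_density c x) * indicator (cmap c ` (B \<inter> cdom c)) x \<partial>lborel)"
    using cmap_in[of _ c] by (intro nn_integral_cong) (auto simp: indicator_def)
  finally show ?thesis .
qed

text \<open>Under a change of chart sqrt (det g) is multiplied by the absolute value of the Jacobian
  determinant, which is exactly the factor in the change of variables formula.\<close>

lemma chart_volumes_agree:
  assumes c: "c \<in> A" and d: "d \<in> A" and B: "B \<in> sets borel_sigma" "B \<subseteq> cdom c" "B \<subseteq> cdom d"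
  shows "emeasure (chart_volume c) B = emeasure (chart_volume d) B"
proof -
  let ?\<phi> = "\<lambda>x. cmap d (cinv c x)" and ?S = "cmap c ` B"
  let ?\<phi>' = "\<lambda>x. (*v) (transition c d (cinv c x))"
  have S: "?S \<in> sets borel" "cmap d ` B \<in> sets borel"
    using cmap_image_sets c d B by auto
  have img: "?\<phi> ` ?S = cmap d ` B"
    unfolding image_image by (rule image_cong[OF refl]) (use cinv_cmap[OF c] B in auto)
  have ov: "x \<in> ?S \<Longrightarrow> x \<in> overlap c d" for x unfolding overlap_def using B by auto
  have der: "(?\<phi> has_derivative ?\<phi>' x) (at x)" if "x \<in> ?S" for x
  proof -
    have "(cmap d \<circ> cinv c) differentiable (at x)"
      using change_differentiable[OF c d ov[OF that]] by (simp add: comp_def)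
    moreover have "cmap c (cinv c x) = x" using that B(2) cinv_cmap[OF c] by auto
    ultimately show ?thesis unfolding transition_def jacobian_works by (simp add: comp_def)
  qed
  have inj: "inj_on ?\<phi> ?S"
    using B(3) inj_on_cmap[OF d] cinv_cmap[OF c, OF subsetD[OF B(2)]]
    unfolding inj_on_def by (metis (no_types, lifting) imageE subsetD)
  have dens_eq: "\<bar>det (matrix (?\<phi>' x))\<bar> * vol_density d (?\<phi> x) = vol_density c x" if "x \<in> ?S" for x
    using that B vol_density_change[OF c _ d] by (auto simp: subset_iff cinv_cmap[OF c])
  \<comment> \<open>A density is continuous only on the range of its chart, so it is cut off by the indicator
    of a Borel subset of that range before measurability is claimed.\<close>
  have m1: "(\<lambda>y. indicator (?\<phi> ` ?S) y *\<^sub>R vol_density d y) \<in> borel_measurable borel"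
    unfolding img
    by (intro borel_measurable_continuous_on_indicator S
          continuous_on_subset[OF C1_on_imp_continuous_on[OF vol_density_C1[OF d]]])
       (use B cmap_in[of _ d] in auto)
  have "(\<lambda>x. indicator ?S x *\<^sub>R vol_density c x) \<in> borel_measurable borel"
    by (intro borel_measurable_continuous_on_indicator S
          continuous_on_subset[OF C1_on_imp_continuous_on[OF vol_density_C1[OF c]]])
       (use B cmap_in[of _ c] in auto)
  also have "(\<lambda>x. indicator ?S x *\<^sub>R vol_density c x) = (\<lambda>x. indicator ?S x *\<^sub>R (\<bar>det (matrix (?\<phi>' x))\<bar> * vol_density d (?\<phi> x)))"
    using dens_eq by (auto simp: fun_eq_iff indicator_def)
  finally have m2: "(\<lambda>x. indicator ?S x *\<^sub>R (\<bar>det (matrix (?\<phi>' x))\<bar> * vol_density d (?\<phi> x))) \<in> borel_measurable borel" .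
  have pos: "0 \<le> vol_density d (?\<phi> x)" if "x \<in> ?S" for x
  proof -
    from that obtain p where "p \<in> B" "x = cmap c p" by blast
    then show ?thesis using B by (auto simp: subset_iff cinv_cmap[OF c] intro!: vol_density_nonneg[OF d] cmap_in)
  qed
  have "(\<integral>\<^sup>+y. ennreal (vol_density d y) * indicator (cmap d ` B) y \<partial>lborel) =
      (\<integral>\<^sup>+x. ennreal (\<bar>det (matrix (?\<phi>' x))\<bar> * vol_density d (?\<phi> x)) * indicator ?S x \<partial>lborel)"
    using nn_integral_change_of_variables[OF S(1) der inj m1 m2 pos] unfolding img .
  also have "\<dots> = (\<integral>\<^sup>+x. ennreal (vol_density c x) * indicator ?S x \<partial>lborel)"
    using dens_eq by (intro nn_integral_cong) (auto simp: indicator_def)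
  finally show ?thesis
    using B by (simp add: emeasure_chart_volume c d Int_absorb2)
qed

text \<open>The characterisation of the volume by its restrictions to charts, in terms of
  measures instead of integrals.\<close>

lemma is_volume_measure_alt:
  "is_volume_measure T A g \<mu> \<longleftrightarrow> sets \<mu> = sets borel_sigma \<and>
     (\<forall>c\<in>A. \<forall>B\<in>sets borel_sigma. B \<subseteq> cdom c \<longrightarrow> emeasure \<mu> B = emeasure (chart_volume c) B)"
proof -
  have 1: "(\<forall>c\<in>A. \<forall>B\<in>sets borel_sigma. B \<subseteq> cdom c \<longrightarrow> emeasure \<mu> B = emeasure (chart_volume c) B) \<longleftrightarrow>
    (\<forall>c\<in>A. \<forall>B\<in>sets borel_sigma. B \<subseteq> cdom c \<longrightarrow>
      emeasure \<mu> B = (\<integral>\<^sup>+ x. ennreal (sqrt (det (g c (cinv c x)))) * indicator (cmap c ` B) x \<partial>lborel))"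
    by (intro ball_cong refl imp_cong) (simp add: emeasure_chart_volume Int_absorb2 vol_density_def)
  show ?thesis
  proof (cases "sets \<mu> = sets borel_sigma")
    case True
    then have "space \<mu> = topspace T" using sets_eq_imp_space_eq space_borel_sigma by metis
    with True show ?thesis unfolding 1 is_volume_measure_def sets_borel_sigma[symmetric] by simp
  next
    case False
    then show ?thesis unfolding is_volume_measure_def sets_borel_sigma[symmetric] by simp
  qed
qed

text \<open>Finitely many chart domains cover the manifold; making them disjoint gives Borel sets D_i,
  each inside one chart. The sum of the chart volumes on the D_i is a measure, and it is correct in
  every chart since the chart volumes agree on overlaps. Any volume measure is determined on the
  subsets of the D_i, hence everywhere.\<close>

lemma volume_measure:
  assumes "compact_space T"
  shows "is_volume_measure T A g (riemannian_volume T A g)"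
proof -
  have "\<exists>F. finite F \<and> F \<subseteq> cdom ` A \<and> topspace T \<subseteq> \<Union>F"
    using assms covers open_dom unfolding compact_space_alt by (metis (no_types, lifting) imageE subset_refl)
  then obtain F where F: "finite F" "F \<subseteq> A" "topspace T \<subseteq> (\<Union>c\<in>F. cdom c)"
    by (metis finite_subset_image)
  obtain cs :: "nat \<Rightarrow> ('a, 'n) chart" and m where cs: "F = cs ` {0..<m}"
    using finite_imp_nat_seg_image_inj_on[OF F(1)] by (metis atLeast0LessThan lessThan_def)
  define D where "D = disjointed (\<lambda>i. cdom (cs i))"
  have csA: "i < m \<Longrightarrow> cs i \<in> A" for i using cs F by auto
  have D_sub: "D i \<subseteq> cdom (cs i)" for i unfolding D_def by (rule disjointed_subset)
  have D_cover: "topspace T \<subseteq> (\<Union>i\<in>{0..<m}. D i)"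
    using F(3) unfolding D_def finite_UN_disjointed_eq cs by auto
  have D_disj: "disjoint_family_on D {0..<m}"
    using disjoint_family_disjointed[of "\<lambda>i. cdom (cs i)"] unfolding D_def disjoint_family_on_def by auto
  have D_sets: "D i \<in> sets borel_sigma" if "i < m" for i
    unfolding D_def disjointed_def using that
    by (auto intro!: sets.Diff sets.finite_UN cdom_sets_borel_sigma csA)
  have split: "emeasure M B = (\<Sum>i=0..<m. emeasure M (B \<inter> D i))" if "sets M = sets borel_sigma" "B \<in> sets borel_sigma" for M B
  proof (rule sum_emeasure_cover[OF _ _ _ _ D_disj])
    show "B \<subseteq> (\<Union>i\<in>{0..<m}. D i)"
      using D_cover sets.sets_into_space[OF that(2)] by (auto simp: space_borel_sigma)
  qed (use that D_sets in auto)
  define V where "V B = (\<Sum>i=0..<m. emeasure (chart_volume (cs i)) (B \<inter> D i))" for B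
  define \<mu> where "\<mu> = measure_of (topspace T) {U. openin T U} V"
  have sets_\<mu>: "sets \<mu> = sets borel_sigma" unfolding \<mu>_def sets_borel_sigma using opens_subset by (rule sets_measure_of)
  have emeasure_\<mu>: "emeasure \<mu> B = V B" if "B \<in> sets borel_sigma" for B
  proof (rule emeasure_measure_of[OF \<mu>_def opens_subset])
    show "B \<in> sets \<mu>" using that sets_\<mu> by simp
    show "positive (sets \<mu>) V" by (simp add: positive_def V_def)
    show "countably_additive (sets \<mu>) V"
    proof (rule countably_additiveI)
      fix B :: "nat \<Rightarrow> 'a set"
      assume B: "range B \<subseteq> sets \<mu>" "disjoint_family B"
      have "(\<Sum>n. V (B n)) = (\<Sum>i=0..<m. \<Sum>n. emeasure (chart_volume (cs i)) (B n \<inter> D i))"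
        unfolding V_def by (rule suminf_sum) (rule summableI)
      also have "\<dots> = (\<Sum>i=0..<m. emeasure (chart_volume (cs i)) (\<Union>n. B n \<inter> D i))"
      proof (intro sum.cong refl suminf_emeasure)
        fix i assume i: "i \<in> {0..<m}"
        show "range (\<lambda>n. B n \<inter> D i) \<subseteq> sets (chart_volume (cs i))"
          using B(1) D_sets[of i] i by (auto simp: sets_\<mu>)
        show "disjoint_family (\<lambda>n. B n \<inter> D i)"
          using B(2) unfolding disjoint_family_on_def by auto
      qed
      also have "\<dots> = V (\<Union>n. B n)"
        unfolding V_def by (intro sum.cong refl arg_cong[of _ _ "emeasure _"]) auto
      finally show "(\<Sum>n. V (B n)) = V (\<Union>n. B n)" .
    qed
  qed
  have ex: "is_volume_measure T A g \<mu>"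
    unfolding is_volume_measure_alt
  proof (intro conjI ballI impI sets_\<mu>)
    fix c B assume c: "c \<in> A" and B: "B \<in> sets borel_sigma" "B \<subseteq> cdom c"
    have "emeasure \<mu> B = (\<Sum>i=0..<m. emeasure (chart_volume c) (B \<inter> D i))"
      unfolding emeasure_\<mu>[OF B(1)] V_def
    proof (rule sum.cong[OF refl])
      fix i assume "i \<in> {0..<m}"
      then show "emeasure (chart_volume (cs i)) (B \<inter> D i) = emeasure (chart_volume c) (B \<inter> D i)"
        using B D_sub[of i] by (intro chart_volumes_agree csA c sets.Int D_sets) auto
    qed
    also have "\<dots> = emeasure (chart_volume c) B" by (rule split[symmetric]) (use B in auto)
    finally show "emeasure \<mu> B = emeasure (chart_volume c) B" .
  qed
  have uniq: "\<nu> = \<mu>" if \<nu>: "is_volume_measure T A g \<nu>" for \<nu>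
  proof (rule measure_eqI)
    show "sets \<nu> = sets \<mu>" using \<nu> sets_\<mu> unfolding is_volume_measure_alt by simp
    fix B assume "B \<in> sets \<nu>"
    then have B: "B \<in> sets borel_sigma" and s: "sets \<nu> = sets borel_sigma" using \<nu> unfolding is_volume_measure_alt by auto
    have "emeasure \<nu> (B \<inter> D i) = emeasure (chart_volume (cs i)) (B \<inter> D i)" if "i < m" for i
      using \<nu> csA[OF that] sets.Int[OF B D_sets[OF that]] D_sub[of i] le_infI2
      unfolding is_volume_measure_alt by metis
    then have "emeasure \<nu> B = V B" unfolding split[OF s B] V_def by simp
    then show "emeasure \<nu> B = emeasure \<mu> B" using emeasure_\<mu>[OF B] by simp
  qed
  show ?thesis unfolding riemannian_volume_def using ex uniq by (rule theI)
qed

text \<open>Integration of a function that vanishes outside one chart, in coordinates. The function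
  is given by its density k with respect to Lebesgue measure, which is the form in which the
  divergence of a field appears.\<close>

lemma has_bochner_integral_in_chart:
  assumes \<mu>: "is_volume_measure T A g \<mu>" and c: "c \<in> A"
    and k: "has_bochner_integral lborel k I" and k0: "\<And>x. x \<notin> crange c \<Longrightarrow> k x = 0"
  shows "has_bochner_integral \<mu> (\<lambda>p. if p \<in> cdom c then k (cmap c p) / vol_density c (cmap c p) else 0) I"
proof -
  let ?R = "restrict_space lborel (crange c)"
  let ?h = "\<lambda>p. if p \<in> cdom c then k (cmap c p) / vol_density c (cmap c p) else 0"
  have sets_\<mu>: "sets \<mu> = sets borel_sigma" using \<mu> unfolding is_volume_measure_alt by simp
  have dom: "cdom c \<in> sets \<mu>" using cdom_sets_borel_sigma[OF c] sets_\<mu> by simp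
  have km: "k \<in> borel_measurable borel" using k by (auto dest: borel_measurable_has_bochner_integral)
  have cm: "cmap c \<in> measurable (restrict_space \<mu> (cdom c)) borel"
  proof (rule borel_measurableI)
    fix S :: "(real ^ 'n::_) set" assume "open S"
    then have "{p \<in> cdom c. cmap c p \<in> S} \<in> sets borel_sigma" using openin_cmap_vimage[OF c] openin_sets_borel_sigma by blast
    moreover have "cmap c -` S \<inter> space (restrict_space \<mu> (cdom c)) = {p \<in> cdom c. cmap c p \<in> S}"
      using sets.sets_into_space[OF dom] by (auto simp: space_restrict_space)
    ultimately show "cmap c -` S \<inter> space (restrict_space \<mu> (cdom c)) \<in> sets (restrict_space \<mu> (cdom c))"
      using dom sets.sets_into_space[OF dom] by (subst sets_restrict_space_iff) (auto simp: sets_\<mu>)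
  qed
  have dm: "(\<lambda>x. indicator (crange c) x *\<^sub>R vol_density c x) \<in> borel_measurable borel"
    using open_range[OF c] by (intro borel_measurable_continuous_on_indicator C1_on_imp_continuous_on vol_density_C1 c) auto
  have hm: "?h \<in> borel_measurable borel_sigma"
  proof -
    have "(\<lambda>p. k (cmap c p) / (indicator (crange c) (cmap c p) *\<^sub>R vol_density c (cmap c p))) \<in> borel_measurable (restrict_space \<mu> (cdom c))"
      using measurable_compose[OF cm km] measurable_compose[OF cm dm] by measurable
    then have "(\<lambda>p. indicator (cdom c) p *\<^sub>R (k (cmap c p) / (indicator (crange c) (cmap c p) *\<^sub>R vol_density c (cmap c p)))) \<in> borel_measurable \<mu>"
      using dom sets.sets_into_space[OF dom] by (subst (asm) borel_measurable_restrict_space_iff) (auto simp: Int_absorb2)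
    also have "(\<lambda>p. indicator (cdom c) p *\<^sub>R (k (cmap c p) / (indicator (crange c) (cmap c p) *\<^sub>R vol_density c (cmap c p)))) = ?h"
      using cmap_in[of _ c] by (auto simp: fun_eq_iff indicator_def)
    finally show ?thesis by (simp add: measurable_cong_sets[OF sets_\<mu> refl])
  qed
  have hm': "?h \<in> borel_measurable \<mu>" using hm measurable_cong_sets[OF sets_\<mu> refl] by blast
  have im: "(indicator (cdom c) :: 'a \<Rightarrow> real) \<in> borel_measurable \<mu>" using dom by simp
  have "density \<mu> (indicator (cdom c)) = chart_volume c"
  proof (rule measure_eqI)
    show "sets (density \<mu> (indicator (cdom c))) = sets (chart_volume c)" by (simp add: sets_\<mu>)
    fix B assume "B \<in> sets (density \<mu> (indicator (cdom c)))"
    then have B: "B \<in> sets \<mu>" by simp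
    have "emeasure (density \<mu> (indicator (cdom c))) B = emeasure \<mu> (cdom c \<inter> B)"
      using B dom by (simp add: emeasure_density nn_integral_indicator indicator_inter_arith[symmetric])
    also have "\<dots> = emeasure (chart_volume c) (cdom c \<inter> B)"
      using \<mu> c B dom unfolding is_volume_measure_alt by auto
    also have "\<dots> = emeasure (chart_volume c) B"
      using B dom by (simp add: emeasure_chart_volume[OF c] sets_\<mu> Int_commute Int_left_commute)
    finally show "emeasure (density \<mu> (indicator (cdom c))) B = emeasure (chart_volume c) B" .
  qed
  moreover have "has_bochner_integral (chart_volume c) ?h I"
    unfolding chart_volume_def
  proof (rule has_bochner_integral_distr[OF hm])
    show cm: "cinv c \<in> measurable (density ?R (\<lambda>x. ennreal (vol_density c x))) borel_sigma"
      using cinv_measurable[OF c] by simp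
    show "has_bochner_integral (density ?R (\<lambda>x. ennreal (vol_density c x))) (\<lambda>x. ?h (cinv c x)) I"
    proof (rule has_bochner_integral_density)
      show "(\<lambda>x. ?h (cinv c x)) \<in> borel_measurable ?R"
        by (rule measurable_compose[OF cinv_measurable[OF c] hm])
      show "vol_density c \<in> borel_measurable ?R" by (rule vol_density_measurable[OF c])
      show "AE x in ?R. 0 \<le> vol_density c x"
        by (rule AE_I2) (simp add: space_restrict_space vol_density_nonneg c)
      have "has_bochner_integral ?R k I"
        using k k0 open_range[OF c] unfolding has_bochner_integral_iff
        by (subst integrable_restrict_space, simp, subst integral_restrict_space, simp) 
           (metis (no_types, lifting) Bochner_Integration.integrable_cong Bochner_Integration.integral_cong indicator_simps scaleR_one scaleR_zero_left)
      moreover have "vol_density c x *\<^sub>R ?h (cinv c x) = k x" if "x \<in> space ?R" for x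
      proof -
        have "x \<in> crange c" using that by (simp add: space_restrict_space)
        then show ?thesis using vol_density_pos[OF c, of x] by (simp add: cinv_in cmap_cinv)
      qed
      ultimately show "has_bochner_integral ?R (\<lambda>x. vol_density c x *\<^sub>R ?h (cinv c x)) I"
        by (subst has_bochner_integral_cong[OF refl _ refl, where g = k]) auto
    qed
  qed
  ultimately have "has_bochner_integral (density \<mu> (\<lambda>p. ennreal (indicator (cdom c) p))) ?h I"
    by (simp add: ennreal_indicator)
  then have "has_bochner_integral \<mu> (\<lambda>p. indicator (cdom c) p *\<^sub>R ?h p) I"
    using integrable_density[OF hm' im] integral_density[OF hm' im] by (simp add: has_bochner_integral_iff)
  moreover have "(\<lambda>p. indicator (cdom c) p *\<^sub>R ?h p) = ?h" by (auto simp: fun_eq_iff indicator_def)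
  ultimately show ?thesis by simp
qed

end

section \<open>Partitions of unity and the divergence theorem\<close>

lemma DERIV_max_square: "((\<lambda>s::real. (max 0 s)\<^sup>2) has_real_derivative 2 * max 0 s) (at s)"
proof -
  consider "s < 0" | "s = 0" | "s > 0" by linarith
  then show ?thesis
  proof cases
    case 1
    have "((\<lambda>s::real. 0) has_real_derivative 2 * max 0 s) (at s)" using 1 by simp
    then show ?thesis
      by (rule has_field_derivative_transform_within_open[where S = "{..<0}"]) (use 1 in auto)
  next
    case 2
    have "((\<lambda>y::real. max 0 y) \<longlongrightarrow> max 0 0) (at 0)" by (intro tendsto_intros)
    then have "((\<lambda>y::real. max 0 y) \<longlongrightarrow> 0) (at 0)" by simp
    then have "((\<lambda>y::real. ((max 0 y)\<^sup>2 - (max 0 0)\<^sup>2) / (y - 0)) \<longlongrightarrow> 0) (at 0)"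
      by (rule Lim_transform_eventually) (auto simp: eventually_at_filter max_def power2_eq_square)
    then show ?thesis using 2 by (simp add: has_field_derivative_iff)
  next
    case 3
    have "((\<lambda>s::real. s\<^sup>2) has_real_derivative 2 * max 0 s) (at s)"
      using 3 by (auto intro!: derivative_eq_intros)
    then show ?thesis
      by (rule has_field_derivative_transform_within_open[where S = "{0<..}"]) (use 3 in auto)
  qed
qed

text \<open>The square of the positive part has a continuous derivative, so this function, which is positive
  exactly on a ball, is of class C^1.\<close>

lemma C1_bump:
  fixes a :: "real ^ 'n::finite"
  shows "C1_on U (\<lambda>x. (max 0 (r\<^sup>2 - (x - a) \<bullet> (x - a)))\<^sup>2)"
proof (rule C1_onI)
  fix x
  have "((\<lambda>x. r\<^sup>2 - (x - a) \<bullet> (x - a)) has_derivative (\<lambda>v. - (2 * ((x - a) \<bullet> v)))) (at x)"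
    by (auto intro!: derivative_eq_intros simp: inner_commute)
  from has_derivative_compose[OF this DERIV_max_square[unfolded has_field_derivative_def]]
  show "((\<lambda>x. (max 0 (r\<^sup>2 - (x - a) \<bullet> (x - a)))\<^sup>2) has_derivative
     (\<lambda>v. 2 * max 0 (r\<^sup>2 - (x - a) \<bullet> (x - a)) * - (2 * ((x - a) \<bullet> v)))) (at x)" .
next
  show "continuous_on U (\<lambda>x. 2 * max 0 (r\<^sup>2 - (x - a) \<bullet> (x - a)) * - (2 * ((x - a) \<bullet> axis i 1)))" for i
    by (intro continuous_intros)
qed

context smooth_manifold
begin

text \<open>Closedness of K in the whole manifold is essential: any other chart is covered by the
  overlap with c, where the chain rule applies, and the open complement of K, where the function is
  zero. For a compact K it is the Hausdorff property that provides this.\<close>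

lemma C1_fun_extend:
  assumes c: "c \<in> A" and \<beta>: "C1_on (crange c) \<beta>" and K: "closedin T K" "K \<subseteq> cdom c"
    and supp: "\<And>q. q \<in> cdom c \<Longrightarrow> q \<notin> K \<Longrightarrow> \<beta> (cmap c q) = 0"
  shows "C1_fun (\<lambda>q. if q \<in> cdom c then \<beta> (cmap c q) else 0)"
  unfolding C1_fun_def
proof
  fix d assume d: "d \<in> A"
  let ?b = "(\<lambda>q. if q \<in> cdom c then \<beta> (cmap c q) else 0) \<circ> cinv d"
  let ?V = "cmap d ` (cdom d - K)"
  have op: "openin T (cdom d - K)" using open_dom[OF d] K(1) by (rule openin_diff)
  have oV: "open ?V" by (rule open_cmap_image[OF d op]) auto
  have oO: "open (overlap d c)" by (rule open_overlap[OF d c])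
  have "C1_on (overlap d c) (\<lambda>x. \<beta> (cmap c (cinv d x)))"
    by (rule C1_on_compose[OF \<beta> change_differentiable[OF d c] change_C1[OF d c]])
       (auto intro: cmap_in elim: overlapE[OF d])
  moreover have "x \<in> overlap d c \<Longrightarrow> ?b x = \<beta> (cmap c (cinv d x))" for x
    by (rule overlapE[OF d]) auto
  ultimately have 1: "C1_on (overlap d c) ?b"
    by (metis (no_types, lifting) C1_on_cong[OF oO])
  have "?b x = 0" if x: "x \<in> ?V" for x
  proof -
    obtain q where "q \<in> cdom d" "q \<notin> K" "x = cmap d q" using x by auto
    then show ?thesis using supp by (simp add: cinv_cmap[OF d])
  qed
  then have 2: "C1_on ?V ?b"
    using C1_on_const[of ?V 0] C1_on_cong[OF oV, of ?b "\<lambda>x. 0"] by simp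
  have "crange d = overlap d c \<union> ?V" unfolding crange_def overlap_def using K(2) by auto
  then show "C1_on (crange d) ?b" using C1_on_Un[OF oO oV 1 2] by simp
qed

lemma bump_function_exists:
  assumes p: "p \<in> topspace T"
  obtains c K U b where "c \<in> A" "closedin T K" "K \<subseteq> cdom c" "compact (cmap c ` K)"
    "openin T U" "p \<in> U" "C1_fun b" "\<And>q. b q \<ge> 0" "\<And>q. q \<notin> K \<Longrightarrow> b q = 0" "\<And>q. q \<in> U \<Longrightarrow> b q > 0"
proof -
  define c where "c = chart_at A p"
  have c: "c \<in> A" "p \<in> cdom c" unfolding c_def using p chart_at by auto
  define a where "a = cmap c p"
  obtain r where r: "r > 0" "cball a r \<subseteq> crange c"
    using open_range[OF c(1)] cmap_in[OF c(2)] open_contains_cball unfolding a_def by metis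
  define K where "K = {q \<in> cdom c. cmap c q \<in> cball a r}"
  define U where "U = {q \<in> cdom c. cmap c q \<in> ball a r}"
  define \<beta> where "\<beta> x = (max 0 (r\<^sup>2 - (x - a) \<bullet> (x - a)))\<^sup>2" for x
  define b where "b q = (if q \<in> cdom c then \<beta> (cmap c q) else 0)" for q
  have K_sub: "K \<subseteq> cdom c" unfolding K_def by auto
  have K_img: "cmap c ` K = cball a r"
    unfolding K_def using r(2) by (auto simp: crange_def)
  have "compactin (top_of_set (crange c)) (cmap c ` K)"
    unfolding K_img using r(2) by (simp add: compactin_subtopology)
  then have "compactin (subtopology T (cdom c)) K"
    using homeomorphic_map_compactness_eq[OF homeo[OF c(1)], of K] K_sub cdom_subset[OF c(1)] by auto
  then have "closedin T K"
    using compactin_imp_closedin[OF Hausdorff] by (simp add: compactin_subtopology)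
  moreover have "openin T U" unfolding U_def by (rule openin_cmap_vimage[OF c(1) open_ball])
  moreover have dist: "(x - a) \<bullet> (x - a) = (dist a x)\<^sup>2" for x
    by (metis dist_commute dist_norm power2_norm_eq_inner)
  have zero: "\<beta> x = 0" if "x \<notin> cball a r" for x
  proof -
    have "r\<^sup>2 \<le> (dist a x)\<^sup>2" using that r(1) by (intro power_mono) auto
    then show ?thesis by (simp add: \<beta>_def dist)
  qed
  have pos: "\<beta> x > 0" if "x \<in> ball a r" for x
  proof -
    have "(dist a x)\<^sup>2 < r\<^sup>2" using that by (intro power_strict_mono) auto
    then show ?thesis by (simp add: \<beta>_def dist)
  qed
  have "C1_fun b" unfolding b_def
  proof (rule C1_fun_extend[OF c(1) _ \<open>closedin T K\<close> K_sub])
    show "C1_on (crange c) \<beta>" unfolding \<beta>_def[abs_def] by (rule C1_bump)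
    show "q \<in> cdom c \<Longrightarrow> q \<notin> K \<Longrightarrow> \<beta> (cmap c q) = 0" for q
      by (rule zero) (auto simp: K_def)
  qed
  ultimately show ?thesis
    using that[of c K U b] c K_sub K_img r(1) zero pos
    by (auto simp: b_def U_def a_def K_def \<beta>_def)
qed

text \<open>The index set consists of points of the manifold; a bump function is chosen at each of them,
  and finitely many of these have a positive sum, by which they are divided. That the supports have
  compact images in the charts is what makes integration by parts possible.\<close>

lemma partition_of_unity:
  assumes "compact_space T"
  obtains F :: "'a set" and ch K \<rho> where "finite F"
    "\<And>a. a \<in> F \<Longrightarrow> ch a \<in> A" "\<And>a. a \<in> F \<Longrightarrow> closedin T (K a)" "\<And>a. a \<in> F \<Longrightarrow> K a \<subseteq> cdom (ch a)"
    "\<And>a. a \<in> F \<Longrightarrow> compact (cmap (ch a) ` K a)" "\<And>a. a \<in> F \<Longrightarrow> C1_fun (\<rho> a)"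
    "\<And>a q. a \<in> F \<Longrightarrow> q \<notin> K a \<Longrightarrow> \<rho> a q = 0" "\<And>q. q \<in> topspace T \<Longrightarrow> (\<Sum>a\<in>F. \<rho> a q) = 1"
proof -
  have "\<forall>p\<in>topspace T. \<exists>c K U b. c \<in> A \<and> closedin T K \<and> K \<subseteq> cdom c \<and> compact (cmap c ` K) \<and>
    openin T U \<and> p \<in> U \<and> C1_fun b \<and> (\<forall>q. b q \<ge> 0) \<and> (\<forall>q. q \<notin> K \<longrightarrow> b q = 0) \<and> (\<forall>q\<in>U. b q > 0)"
    using bump_function_exists by (metis (no_types, lifting))
  then obtain ch K U b where H: "\<And>p. p \<in> topspace T \<Longrightarrow> ch p \<in> A \<and> closedin T (K p) \<and> K p \<subseteq> cdom (ch p) \<and>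
      compact (cmap (ch p) ` K p) \<and> openin T (U p) \<and> p \<in> U p \<and> C1_fun (b p) \<and> (\<forall>q. b p q \<ge> 0) \<and>
      (\<forall>q. q \<notin> K p \<longrightarrow> b p q = 0) \<and> (\<forall>q\<in>U p. b p q > 0)"
    by metis
  have "\<exists>F'. finite F' \<and> F' \<subseteq> U ` topspace T \<and> topspace T \<subseteq> \<Union>F'"
    using assms[unfolded compact_space_alt, rule_format, of "U ` topspace T"] H by blast
  then obtain F where F: "finite F" "F \<subseteq> topspace T" "topspace T \<subseteq> (\<Union>a\<in>F. U a)"
    by (metis finite_subset_image)
  define S where "S q = (\<Sum>a\<in>F. b a q)" for q
  have S: "S q > 0" if "q \<in> topspace T" for q
  proof -
    from that F(3) obtain a where "a \<in> F" "q \<in> U a" by blast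
    then show ?thesis unfolding S_def using F H by (intro sum_pos2[of F a]) auto
  qed
  have C1: "C1_fun (\<lambda>q. b a q / S q)" if a: "a \<in> F" for a
    unfolding C1_fun_def
  proof
    fix c assume c: "c \<in> A"
    have b: "C1_on (crange c) (\<lambda>x. b a (cinv c x))" if "a \<in> F" for a
      using H[of a] F(2) that c unfolding C1_fun_def by (auto simp: comp_def)
    have "C1_on (crange c) (\<lambda>x. b a (cinv c x) / S (cinv c x))"
    proof (rule C1_on_divide[OF b[OF a]])
      show "C1_on (crange c) (\<lambda>x. S (cinv c x))" unfolding S_def by (intro C1_on_sum b)
      fix x assume "x \<in> crange c"
      then have "cinv c x \<in> topspace T" using cinv_in cdom_subset[OF c] by blast
      then show "S (cinv c x) \<noteq> 0" using S[of "cinv c x"] by simp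
    qed
    then show "C1_on (crange c) ((\<lambda>q. b a q / S q) \<circ> cinv c)" by (simp add: comp_def)
  qed
  show ?thesis
  proof (rule that[of F ch K "\<lambda>a q. b a q / S q"])
    show "(\<Sum>a\<in>F. b a q / S q) = 1" if "q \<in> topspace T" for q
      using S[OF that] by (simp add: S_def flip: sum_divide_distrib)
  qed (use F H C1 in \<open>auto simp: subset_iff\<close>)
qed

end

context riemannian_manifold
begin

text \<open>The function D plays the role of div W; it is characterised by the coordinate formula
  for the divergence in every chart. For a partition of unity \<rho>_a, the divergence of \<rho>_a W is
  \<rho>_a D + W(\<rho>_a), and its integral vanishes since the field has compact support in a chart. Summing
  over a leaves the integral of D because the sum of the W(\<rho>_a) is W(1) = 0.\<close>

theorem divergence_theorem:
  assumes comp: "compact_space T" and \<mu>: "is_volume_measure T A g \<mu>"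
    and W: "transforms_as_vector W"
    and W_C1: "\<And>c i. c \<in> A \<Longrightarrow> C1_on (crange c) (\<lambda>x. W c (cinv c x) $ i)"
    and D: "\<And>c p. c \<in> A \<Longrightarrow> p \<in> cdom c \<Longrightarrow>
      (\<Sum>i\<in>UNIV. partial c i (\<lambda>p. sqrt (det (g c p)) * W c p $ i) p) = sqrt (det (g c p)) * D p"
  shows "has_bochner_integral \<mu> D 0"
proof -
  obtain F :: "'a set" and ch K \<rho> where F: "finite F"
    and ch: "\<And>a. a \<in> F \<Longrightarrow> ch a \<in> A" and K: "\<And>a. a \<in> F \<Longrightarrow> closedin T (K a)" 
    and K_sub: "\<And>a. a \<in> F \<Longrightarrow> K a \<subseteq> cdom (ch a)"
    and K_compact: "\<And>a. a \<in> F \<Longrightarrow> compact (cmap (ch a) ` K a)" and \<rho>: "\<And>a. a \<in> F \<Longrightarrow> C1_fun (\<rho> a)"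
    and supp: "\<And>a q. a \<in> F \<Longrightarrow> q \<notin> K a \<Longrightarrow> \<rho> a q = 0"
    and sum1: "\<And>q. q \<in> topspace T \<Longrightarrow> (\<Sum>a\<in>F. \<rho> a q) = 1"
    using partition_of_unity[OF comp] by blast
  define h where "h a p = (if p \<in> cdom (ch a) then \<rho> a p * D p + (\<Sum>i\<in>UNIV. W (ch a) p $ i * partial (ch a) i (\<rho> a) p) else 0)" for a p
  \<comment> \<open>In the chart at a, the function h is the divergence of \<rho>_a W. Its density with respect
    to Lebesgue measure is a sum of partial derivatives of compactly supported functions.\<close>
  have h_int: "has_bochner_integral \<mu> (h a) 0" if a: "a \<in> F" for a
  proof -
    define c where "c = ch a"
    have c: "c \<in> A" using ch a by (simp add: c_def)
    define V where "V i x = (if x \<in> crange c then \<rho> a (cinv c x) * (vol_density c x * W c (cinv c x) $ i) else 0)" for i x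
    let ?K = "cmap c ` K a"
    have K_range: "?K \<subseteq> crange c" using K_sub[OF a] cmap_in[of _ c] by (auto simp: c_def)
    have V0: "V i x = 0" if "x \<notin> ?K" for i x
    proof (cases "x \<in> crange c")
      case True
      then have "cinv c x \<notin> K a" using that cmap_cinv[OF True] by (metis imageI)
      then show ?thesis using supp[OF a] by (simp add: V_def)
    qed (simp add: V_def)
    have \<rho>c: "C1_on (crange c) (\<lambda>x. \<rho> a (cinv c x))" using \<rho>[OF a] c unfolding C1_fun_def by (simp add: comp_def)
    have gWc: "C1_on (crange c) (\<lambda>x. vol_density c x * W c (cinv c x) $ i)" for i
      by (intro C1_on_mult vol_density_C1 W_C1 c)
    have V_C1: "C1_on UNIV (V i)" for i
    proof -
      have oK: "open (- ?K)" using compact_imp_closed[OF K_compact[OF a]] by (simp add: c_def open_Compl)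
      have 1: "C1_on (crange c) (V i)"
        by (subst C1_on_cong[OF open_range[OF c], where g = "\<lambda>x. \<rho> a (cinv c x) * (vol_density c x * W c (cinv c x) $ i)"])
           (auto simp: V_def intro: C1_on_mult \<rho>c gWc)
      have 2: "C1_on (- ?K) (V i)"
        by (subst C1_on_cong[OF oK, where g = "\<lambda>x. 0"]) (auto intro: V0 C1_on_const)
      have "crange c \<union> - ?K = UNIV" using K_range by auto
      then show ?thesis using C1_on_Un[OF open_range[OF c] oK 1 2] by simp
    qed
    define k where "k x = (\<Sum>i\<in>UNIV. pd i (V i) x)" for x
    have "has_bochner_integral lborel k (\<Sum>i\<in>(UNIV::'n set). 0)"
      unfolding k_def
      by (intro has_bochner_integral_sum has_bochner_integral_pd_compact_support[OF V_C1 K_compact[OF a]])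
         (auto simp: c_def[symmetric] intro: V0)
    then have k_int: "has_bochner_integral lborel k 0" by simp
    have k0: "k x = 0" if "x \<notin> crange c" for x
    proof -
      have "pd i (V i) x = pd i (\<lambda>x. 0) x" for i
        by (rule derivative_local[where U = "- ?K"])
           (use that K_range compact_imp_closed[OF K_compact[OF a]] V0 in \<open>auto simp: c_def open_Compl\<close>)
      then show ?thesis by (simp add: k_def)
    qed
    have k_eq: "k (cmap c p) / vol_density c (cmap c p) = h a p" if p: "p \<in> cdom c" for p
    proof -
      let ?x = "cmap c p"
      have x: "?x \<in> crange c" using p by (rule cmap_in)
      have cp: "cinv c ?x = p" using c p by (rule cinv_cmap)
      have "pd i (V i) ?x = partial c i (\<rho> a) p * (vol_density c ?x * W c p $ i) + \<rho> a p * partial c i (\<lambda>p. sqrt (det (g c p)) * W c p $ i) p" for i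
      proof -
        have "pd i (V i) ?x = pd i (\<lambda>x. \<rho> a (cinv c x) * (vol_density c x * W c (cinv c x) $ i)) ?x"
          by (rule derivative_local[OF open_range[OF c] x]) (simp add: V_def)
        also have "\<dots> = pd i (\<lambda>x. \<rho> a (cinv c x)) ?x * (vol_density c ?x * W c p $ i) + \<rho> a p * pd i (\<lambda>x. vol_density c x * W c (cinv c x) $ i) ?x"
          using pd_mult[OF C1_on_differentiable[OF \<rho>c x] C1_on_differentiable[OF gWc x]] by (simp add: cp)
        finally show ?thesis by (simp add: partial_eq_pd comp_def vol_density_def)
      qed
      then have "k ?x = (\<Sum>i\<in>UNIV. partial c i (\<rho> a) p * (vol_density c ?x * W c p $ i)) + \<rho> a p * (\<Sum>i\<in>UNIV. partial c i (\<lambda>p. sqrt (det (g c p)) * W c p $ i) p)"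
        by (simp add: k_def sum.distrib sum_distrib_left)
      also have "\<dots> = vol_density c ?x * ((\<Sum>i\<in>UNIV. W c p $ i * partial c i (\<rho> a) p) + \<rho> a p * D p)"
        unfolding D[OF c p] by (simp add: vol_density_def cp sum_distrib_left distrib_left mult_ac)
      finally show ?thesis using p vol_density_pos[OF c x] by (simp add: h_def c_def)
    qed
    have "(\<lambda>p. if p \<in> cdom c then k (cmap c p) / vol_density c (cmap c p) else 0) = h a"
      using k_eq by (auto simp: fun_eq_iff h_def c_def)
    then show ?thesis using has_bochner_integral_in_chart[OF \<mu> c k_int k0] by simp
  qed
  have "has_bochner_integral \<mu> (\<lambda>p. \<Sum>a\<in>F. h a p) (\<Sum>a\<in>F. 0)"
    by (intro has_bochner_integral_sum h_int)
  moreover have "(\<Sum>a\<in>F. h a p) = D p" if p: "p \<in> topspace T" for p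
  proof -
    define d where "d = chart_at A p"
    have d: "d \<in> A" "p \<in> cdom d" unfolding d_def using p chart_at by auto
    \<comment> \<open>Expressing all terms in one common chart d makes the sum over a possible. If p is outside
      the chart at a, then \<rho>_a vanishes in a neighbourhood of p.\<close>
    have h_d: "h a p = \<rho> a p * D p + (\<Sum>i\<in>UNIV. W d p $ i * partial d i (\<rho> a) p)" if a: "a \<in> F" for a
    proof (cases "p \<in> cdom (ch a)")
      case True
      then show ?thesis unfolding h_def using directional_derivative_invariant[OF W \<rho>[OF a] ch[OF a] _ d] by simp
    next
      case False
      then have pK: "p \<notin> K a" using K_sub[OF a] by auto
      have "partial d i (\<rho> a) p = pd i (\<lambda>x. 0) (cmap d p)" for i
        unfolding partial_eq_pd
      proof (rule derivative_local)
        show "open (cmap d ` (cdom d - K a))"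
          using openin_diff[OF open_dom[OF d(1)] K[OF a]] by (intro open_cmap_image d) auto
        show "cmap d p \<in> cmap d ` (cdom d - K a)" using d pK by auto
        show "(\<rho> a \<circ> cinv d) y = 0" if "y \<in> cmap d ` (cdom d - K a)" for y
          using that supp[OF a] by (auto simp: cinv_cmap[OF d(1)])
      qed
      then show ?thesis using False pK supp[OF a] by (simp add: h_def)
    qed
    \<comment> \<open>The \<rho>_a add up to the constant 1.\<close>
    have zero: "(\<Sum>a\<in>F. partial d i (\<rho> a) p) = 0" for i
    proof -
      have x: "cmap d p \<in> crange d" using d(2) by (rule cmap_in)
      have "(\<Sum>a\<in>F. partial d i (\<rho> a) p) = pd i (\<lambda>x. \<Sum>a\<in>F. (\<rho> a \<circ> cinv d) x) (cmap d p)"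
        unfolding partial_eq_pd
        by (rule pd_sum[symmetric]) (use C1_fun_differentiable[OF \<rho> d] in auto)
      also have "\<dots> = pd i (\<lambda>x. 1) (cmap d p)"
      proof (rule derivative_local[OF open_range[OF d(1)] x])
        fix y assume "y \<in> crange d"
        then have "cinv d y \<in> topspace T" using cinv_in cdom_subset[OF d(1)] by blast
        then show "(\<Sum>a\<in>F. (\<rho> a \<circ> cinv d) y) = 1" using sum1 by simp
      qed
      finally show ?thesis by simp
    qed
    have "(\<Sum>a\<in>F. h a p) = (\<Sum>a\<in>F. \<rho> a p) * D p + (\<Sum>i\<in>UNIV. W d p $ i * (\<Sum>a\<in>F. partial d i (\<rho> a) p))"
      by (simp add: h_d sum.distrib sum_distrib_left sum_distrib_right)  (rule sum.swap)
    then show ?thesis using sum1[OF p] by (simp add: zero)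
  qed
  moreover have "space \<mu> = topspace T" using \<mu> unfolding is_volume_measure_def by simp
  ultimately show ?thesis
    using has_bochner_integral_cong[of \<mu> \<mu> "\<lambda>p. \<Sum>a\<in>F. h a p" D 0 0] by simp
qed

end

section \<open>The vector field n q(X) - tr(q) X\<close>

lemma transpose_symD: "transpose M = M \<Longrightarrow> M $ i $ j = M $ j $ i"
  by (metis transpose_def vec_lambda_beta)

context riemannian_manifold
begin

text \<open>In index notation q^i_j X^j, where the first index of q is raised with the metric.\<close>

definition tensor_applied :: "('a, 'n) tensor02 \<Rightarrow> ('a, 'n) vfield \<Rightarrow> ('a, 'n) vfield" where
  "tensor_applied q X c p = matrix_inv (g c p) *v (q c p *v X c p)"

lemma tensor_applied_transforms:
  assumes q: "tensor_field02 A q" and X: "transforms_as_vector X"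
  shows "transforms_as_vector (tensor_applied q X)"
  unfolding transforms_as_vector_def
proof (intro ballI)
  fix c d p assume c: "c \<in> A" and d: "d \<in> A" and p: "p \<in> cdom c \<inter> cdom d"
  let ?J = "transition c d p"
  have qc: "q c p = transpose ?J ** q d p ** ?J" using tensor_change[OF q c _ d] p by simp
  have Xd: "X d p = ?J *v X c p" using X c d p unfolding transforms_as_vector_def by blast
  have Gd: "matrix_inv (g d p) = ?J ** matrix_inv (g c p) ** transpose ?J"
    using matrix_inv_metric_change[OF c _ d] p by simp
  show "tensor_applied q X d p = ?J *v tensor_applied q X c p"
    by (simp only: tensor_applied_def qc Xd Gd matrix_vector_mul_assoc matrix_mul_assoc)
qed

lemma matrix_inv_metric_C1:
  "c \<in> A \<Longrightarrow> C1_on (crange c) (\<lambda>x. matrix_inv (g c (cinv c x)) $ i $ j)"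
  by (rule C1_on_matrix_inv[OF open_range tensor_entries_C1[OF metric_tensor_field]])
     (auto simp: less_imp_neq[OF det_metric_pos, symmetric] cinv_in)

lemma metric_trace_C1:
  assumes q: "tensor_field02 A q"
  shows "C1_fun (metric_trace A g q)"
  unfolding C1_fun_def
proof
  fix c assume c: "c \<in> A"
  have "C1_on (crange c) (\<lambda>x. \<Sum>i\<in>UNIV. \<Sum>j\<in>UNIV. matrix_inv (g c (cinv c x)) $ i $ j * q c (cinv c x) $ i $ j)"
    by (intro C1_on_sum C1_on_mult matrix_inv_metric_C1 tensor_entries_C1 q c)
  then show "C1_on (crange c) (metric_trace A g q \<circ> cinv c)"
    by (subst C1_on_cong[OF open_range[OF c]]) (auto simp: metric_trace_eq[OF q c] cinv_in)
qed

text \<open>The product rule for sqrt (det g) f, with the logarithmic derivative of sqrt (det g) given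
  by Jacobi's formula.\<close>

lemma partial_density:
  assumes c: "c \<in> A" and p: "p \<in> cdom c" and f: "(f \<circ> cinv c) differentiable (at (cmap c p))"
  shows "partial c i (\<lambda>p. sqrt (det (g c p)) * f p) p = sqrt (det (g c p)) *
    (partial c i f p + (1/2) * f p * (\<Sum>a\<in>UNIV. \<Sum>b\<in>UNIV. matrix_inv (g c p) $ a $ b * partial c i (\<lambda>p. g c p $ a $ b) p))"
proof -
  let ?x = "cmap c p"
  have x: "?x \<in> crange c" using p by (rule cmap_in)
  have cp: "cinv c ?x = p" using c p by (rule cinv_cmap)
  have d: "det (g c p) > 0" using c p by (rule det_metric_pos)
  have dg: "(\<lambda>x. g c (cinv c x) $ a $ b) differentiable (at ?x)" for a b
    by (rule C1_on_differentiable[OF tensor_entries_C1[OF metric_tensor_field c] x])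
  have dd: "(\<lambda>x. det (g c (cinv c x))) differentiable (at ?x)"
    by (rule C1_on_differentiable[OF det_metric_C1[OF c] x])
  have ds: "(\<lambda>x. sqrt (det (g c (cinv c x)))) differentiable (at ?x)"
    using differentiable_sqrt[OF dd] d by (simp add: cp)
  have f': "(\<lambda>x. f (cinv c x)) differentiable (at ?x)" using f by (simp add: comp_def)
  have "pd i (\<lambda>x. det (g c (cinv c x))) ?x = det (g c p) *
     (\<Sum>a\<in>UNIV. \<Sum>b\<in>UNIV. matrix_inv (g c p) $ a $ b * pd i (\<lambda>x. g c (cinv c x) $ b $ a) ?x)"
    using pd_det[OF dg] d by (simp add: cp)
  moreover have "pd i (\<lambda>x. g c (cinv c x) $ b $ a) ?x = pd i (\<lambda>x. g c (cinv c x) $ a $ b) ?x" for a b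
    by (rule derivative_local[OF open_range[OF c] x])
       (rule transpose_symD[OF symmetric_metric[OF c cinv_in]])
  ultimately have pdet: "pd i (\<lambda>x. det (g c (cinv c x))) ?x = det (g c p) *
     (\<Sum>a\<in>UNIV. \<Sum>b\<in>UNIV. matrix_inv (g c p) $ a $ b * partial c i (\<lambda>p. g c p $ a $ b) p)"
    by (simp add: partial_eq_pd comp_def)
  have "partial c i (\<lambda>p. sqrt (det (g c p)) * f p) p =
     pd i (\<lambda>x. det (g c (cinv c x))) ?x / (2 * sqrt (det (g c p))) * f p + sqrt (det (g c p)) * partial c i f p"
    using pd_mult[OF ds f'] pd_sqrt[OF dd] d by (simp add: partial_eq_pd comp_def cp)
  also have "pd i (\<lambda>x. det (g c (cinv c x))) ?x / (2 * sqrt (det (g c p))) = sqrt (det (g c p)) / 2 *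
     (\<Sum>a\<in>UNIV. \<Sum>b\<in>UNIV. matrix_inv (g c p) $ a $ b * partial c i (\<lambda>p. g c p $ a $ b) p)"
    unfolding pdet using d by (simp add: field_simps)
  finally show ?thesis by (simp add: algebra_simps)
qed

lemma partial_matrix_inv_metric:
  assumes c: "c \<in> A" and p: "p \<in> cdom c"
  shows "partial c k (\<lambda>p. matrix_inv (g c p) $ i $ j) p =
    - (\<Sum>a\<in>UNIV. \<Sum>b\<in>UNIV. matrix_inv (g c p) $ i $ a * partial c k (\<lambda>p. g c p $ a $ b) p * matrix_inv (g c p) $ b $ j)"
  using pd_matrix_inv[of "crange c" "\<lambda>x. g c (cinv c x)" "cmap c p" k i j, OF open_range[OF c] tensor_entries_C1[OF metric_tensor_field c] _ cmap_in[OF p]]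
    det_metric_pos[OF c] 
  by (simp add: partial_eq_pd comp_def cinv_cmap[OF c p] less_imp_neq[symmetric] cinv_in)

text \<open>div W = (n/2 - 1) X(t) in the coordinates of one chart. In n div Y - div (t X) the terms
  with the conformal factor are n \<sigma> t and - t n \<sigma>.\<close>

lemma conformal_identity:
  assumes c: "c \<in> A" and p: "p \<in> cdom c"
    and X: "conformal_vector_field A g X" and q: "symmetric_tensor_field02 A q"
    and div: "divergence g q c p = (1/2) *\<^sub>R differential (metric_trace A g q) c p"
  defines "t \<equiv> metric_trace A g q"
  defines "W \<equiv> \<lambda>c p. real CARD('n) *\<^sub>R tensor_applied q X c p - t p *\<^sub>R X c p"
  shows "(\<Sum>i\<in>UNIV. partial c i (\<lambda>p. sqrt (det (g c p)) * W c p $ i) p) =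
    sqrt (det (g c p)) * ((real CARD('n) / 2 - 1) * lie_fun A X t p)"
proof -
  let ?x = "cmap c p" and ?n = "real CARD('n)"
  have x: "?x \<in> crange c" using p by (rule cmap_in)
  have cp: "cinv c ?x = p" using c p by (rule cinv_cmap)
  have qt: "tensor_field02 A q" using q unfolding symmetric_tensor_field02_def by simp
  have Xv: "transforms_as_vector X"
    using X unfolding conformal_vector_field_def vector_field_def transforms_as_vector_def by blast
  have X_C1: "C1_on (crange c) (\<lambda>x. X c (cinv c x) $ i)" for i
    using smooth_on_C1_components(2)[of "crange c" "X c \<circ> cinv c"] X c
    unfolding conformal_vector_field_def vector_field_def by (simp add: comp_def)
  obtain \<sigma> where \<sigma>: "lie_tensor02 X g c p = (2 * \<sigma> p) *\<^sub>R g c p"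
    using X c p unfolding conformal_vector_field_def by blast
  define s where "s = \<sigma> p"
  define G where "G i j = matrix_inv (g c p) $ i $ j" for i j
  define \<gamma> where "\<gamma> i j = g c p $ i $ j" for i j
  define q' where "q' i j = q c p $ i $ j" for i j
  define X' where "X' i = X c p $ i" for i
  define dg where "dg k i j = partial c k (\<lambda>x. g c x $ i $ j) p" for k i j
  define dq where "dq k i j = partial c k (\<lambda>x. q c x $ i $ j) p" for k i j
  define dX where "dX i k = partial c i (\<lambda>x. X c x $ k) p" for i k
  define dt where "dt j = partial c j t p" for j
  have g_sym: "\<gamma> i j = \<gamma> j i" for i j unfolding \<gamma>_def by (rule transpose_symD[OF symmetric_metric[OF c p]])
  have G_sym: "G i j = G j i" for i j unfolding G_def
    by (rule transpose_symD) (use det_metric_pos[OF c p] symmetric_metric[OF c p] in \<open>simp add: transpose_matrix_inv\<close>)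
  have qsym: "transpose (q c p) = q c p" if "p \<in> cdom c" for p
    using q c that unfolding symmetric_tensor_field02_def by simp
  have q_sym: "q' i j = q' j i" for i j unfolding q'_def by (rule transpose_symD[OF qsym[OF p]])
  have dg_sym: "dg k i j = dg k j i" for k i j
    unfolding dg_def partial_eq_pd
    by (rule derivative_local[OF open_range[OF c] x])
       (simp add: transpose_symD[OF symmetric_metric[OF c cinv_in]])
  have inv: "(\<Sum>a\<in>UNIV. \<gamma> i a * G a j) = (if i = j then 1 else 0)" for i j
    using matrix_inv_mult(1)[of "g c p"] det_metric_pos[OF c p]
    by (simp add: \<gamma>_def G_def matrix_mult_nth[symmetric] mat_def)
  have conformal: "(\<Sum>k\<in>UNIV. X' k * dg k i j + \<gamma> k j * dX i k + \<gamma> i k * dX j k) = 2 * s * \<gamma> i j" for i j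
    using arg_cong[OF \<sigma>, of "\<lambda>M. M $ i $ j"]
    by (simp add: lie_tensor02_def X'_def dg_def \<gamma>_def dX_def s_def)
  \<comment> \<open>The numbers above satisfy the assumptions under which the algebraic identities were derived.\<close>
  note ctx = g_sym G_sym q_sym dg_sym inv conformal
  have t_tr: "t p = tensor_tr G q'" unfolding tensor_tr_def t_def metric_trace_eq[OF qt c p] G_def q'_def ..
  have div': "(\<Sum>i\<in>UNIV. \<Sum>k\<in>UNIV. G i k * (dq k i j - (\<Sum>l\<in>UNIV. chris G dg l k i * q' l j)
       - (\<Sum>l\<in>UNIV. chris G dg l k j * q' i l))) = dt j / 2" for j
  proof -
    have "christoffel g c p l k i = chris G dg l k i" for l k i
      unfolding christoffel_def chris_def G_def dg_def ..
    then show ?thesis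
      using arg_cong[OF div, of "\<lambda>v. v $ j"]
      by (simp add: divergence_def cov_deriv_def differential_def G_def dq_def q'_def dt_def t_def)
  qed
  let ?H = "\<lambda>i. \<Sum>a\<in>UNIV. \<Sum>b\<in>UNIV. G a b * dg i a b"
  let ?Y = "\<lambda>i. \<Sum>k\<in>UNIV. \<Sum>j\<in>UNIV. G i k * q' k j * X' j"
  let ?dY = "\<lambda>i. \<Sum>k\<in>UNIV. \<Sum>j\<in>UNIV. - (\<Sum>a\<in>UNIV. \<Sum>b\<in>UNIV. G i a * dg i a b * G b k) * q' k j * X' j
      + G i k * dq i k j * X' j + G i k * q' k j * dX i j"
  define Y where "Y i p = (\<Sum>k\<in>UNIV. \<Sum>j\<in>UNIV. matrix_inv (g c p) $ i $ k * q c p $ k $ j * X c p $ j)" for i p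
  have W_Y: "W c p $ i = ?n * Y i p - t p * X c p $ i" for i p
    unfolding W_def tensor_applied_def Y_def
    by (simp add: matrix_vector_mult_def sum_distrib_left mult_ac)
  have dG: "(\<lambda>x. matrix_inv (g c (cinv c x)) $ i $ k) differentiable (at ?x)"
    and dq': "(\<lambda>x. q c (cinv c x) $ i $ k) differentiable (at ?x)"
    and dX': "(\<lambda>x. X c (cinv c x) $ i) differentiable (at ?x)"
    and dt': "(\<lambda>x. t (cinv c x)) differentiable (at ?x)" for i k
    using C1_on_differentiable[OF matrix_inv_metric_C1[OF c] x] C1_on_differentiable[OF tensor_entries_C1[OF qt c] x]
      C1_on_differentiable[OF X_C1 x] C1_fun_differentiable[OF metric_trace_C1[OF qt] c p]
    by (auto simp: t_def comp_def)
  have Y_diff: "(\<lambda>x. Y i (cinv c x)) differentiable (at ?x)" for i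
    unfolding Y_def by (intro differentiable_sum differentiable_mult ballI dG dq' dX' finite)
  have Y_partial: "partial c i (Y i) p = ?dY i" for i
  proof -
    have "partial c i (Y i) p = (\<Sum>k\<in>UNIV. \<Sum>j\<in>UNIV. 
      (partial c i (\<lambda>p. matrix_inv (g c p) $ i $ k) p * q' k j + G i k * dq i k j) * X' j + G i k * q' k j * dX i j)"
      unfolding Y_def partial_eq_pd comp_def G_def q'_def X'_def dq_def dX_def
      by (simp add: pd_sum pd_mult differentiable_sum differentiable_mult dG dq' dX' cp)
    then show ?thesis
      by (simp add: partial_matrix_inv_metric[OF c p] G_def dg_def left_diff_distrib)
  qed
  have W_diff: "((\<lambda>p. W c p $ i) \<circ> cinv c) differentiable (at ?x)" for i
    unfolding W_Y comp_def by (intro differentiable_diff differentiable_mult differentiable_const Y_diff dt' dX')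
  have W_partial: "partial c i (\<lambda>p. W c p $ i) p = ?n * ?dY i - (dt i * X' i + t p * dX i i)" for i
  proof -
    have "partial c i (\<lambda>p. W c p $ i) p = ?n * partial c i (Y i) p - (dt i * X' i + t p * dX i i)"
      unfolding W_Y partial_eq_pd comp_def dt_def dX_def X'_def
      by (simp add: pd_diff pd_cmult pd_mult Y_diff dt' dX' differentiable_mult cp)
    then show ?thesis by (simp only: Y_partial)
  qed
  have "(\<Sum>i\<in>UNIV. partial c i (\<lambda>p. sqrt (det (g c p)) * W c p $ i) p) = sqrt (det (g c p)) *
      (\<Sum>i\<in>UNIV. (?n * ?dY i - (dt i * X' i + t p * dX i i)) + (1/2) * (?n * ?Y i - t p * X' i) * ?H i)"
    unfolding partial_density[OF c p W_diff] W_partial sum_distrib_left[symmetric]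
    by (simp add: W_Y Y_def G_def q'_def X'_def dg_def)
  also have "(\<Sum>i\<in>UNIV. (?n * ?dY i - (dt i * X' i + t p * dX i i)) + (1/2) * (?n * ?Y i - t p * X' i) * ?H i) =
      ?n * ((\<Sum>i\<in>UNIV. ?dY i) + (1/2) * (\<Sum>i\<in>UNIV. ?Y i * ?H i)) - (\<Sum>i\<in>UNIV. X' i * dt i)
      - t p * ((\<Sum>i\<in>UNIV. dX i i) + (1/2) * (\<Sum>i\<in>UNIV. X' i * ?H i))"
  proof -
    have "(\<Sum>i\<in>UNIV. (?n * dY i - (dt i * X' i + t p * dX i i)) + (1/2) * (?n * Y i - t p * X' i) * H i) =
      ?n * ((\<Sum>i\<in>UNIV. dY i) + (1/2) * (\<Sum>i\<in>UNIV. Y i * H i)) - (\<Sum>i\<in>UNIV. X' i * dt i)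
      - t p * ((\<Sum>i\<in>UNIV. dX i i) + (1/2) * (\<Sum>i\<in>UNIV. X' i * H i))" for dY Y H :: "'n \<Rightarrow> real"
      by (simp add: sum_distrib_left sum_subtractf[symmetric] sum.distrib[symmetric] algebra_simps)
    then show ?thesis .
  qed
  also have "\<dots> = ?n * ((1/2) * (\<Sum>j\<in>UNIV. X' j * dt j) + s * t p) - (\<Sum>i\<in>UNIV. X' i * dt i) - t p * (?n * s)"
    unfolding divergence_tensor_applied[OF ctx div'] divergence_conformal[OF ctx] t_tr ..
  also have "\<dots> = (?n / 2 - 1) * (\<Sum>j\<in>UNIV. X' j * dt j)"
    by (simp add: algebra_simps)
  also have "(\<Sum>j\<in>UNIV. X' j * dt j) = lie_fun A X t p"
    unfolding lie_fun_eq[OF Xv metric_trace_C1[OF qt, folded t_def] c p] X'_def dt_def ..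
  finally show ?thesis .
qed

end

theorem theorem3p5:
  fixes T :: "'a topology" and A :: "('a, 'n::{finite, wellorder}) chart set"
    and g q :: "('a, 'n) tensor02" and X :: "('a, 'n) vfield"
  assumes "riemannian_manifold T A g"
    and "compact_space T"
    and "CARD('n) > 2"
    and "conformal_vector_field A g X"
    and "symmetric_tensor_field02 A q"
    and "\<And>c p. c \<in> A \<Longrightarrow> p \<in> cdom c \<Longrightarrow>
           divergence g q c p = (1/2) *\<^sub>R differential (metric_trace A g q) c p"
  shows "has_bochner_integral (riemannian_volume T A g) (lie_fun A X (metric_trace A g q)) 0"
proof -
  interpret riemannian_manifold T A g by fact
  let ?t = "metric_trace A g q" and ?\<mu> = "riemannian_volume T A g" and ?n = "real CARD('n)"
  define W where "W c p = ?n *\<^sub>R tensor_applied q X c p - ?t p *\<^sub>R X c p" for c p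
  have q: "tensor_field02 A q" using assms(5) unfolding symmetric_tensor_field02_def by simp
  have X: "transforms_as_vector X"
    using assms(4) unfolding conformal_vector_field_def vector_field_def transforms_as_vector_def by blast
  have X_C1: "C1_on (crange c) (\<lambda>x. X c (cinv c x) $ i)" if "c \<in> A" for c i
    using smooth_on_C1_components(2)[of "crange c" "X c \<circ> cinv c"] assms(4) that
    unfolding conformal_vector_field_def vector_field_def by (simp add: comp_def)
  have W: "transforms_as_vector W"
    unfolding transforms_as_vector_def
  proof (intro ballI)
    fix c d p assume cd: "c \<in> A" "d \<in> A" "p \<in> cdom c \<inter> cdom d"
    have "X d p = transition c d p *v X c p"
         "tensor_applied q X d p = transition c d p *v tensor_applied q X c p"
      using X tensor_applied_transforms[OF q X] cd unfolding transforms_as_vector_def by blast+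
    then show "W d p = transition c d p *v W c p"
      by (simp add: W_def matrix_vector_mult_diff_distrib matrix_vector_mult_scaleR)
  qed
  have W_C1: "C1_on (crange c) (\<lambda>x. W c (cinv c x) $ i)" if c: "c \<in> A" for c i
    using metric_trace_C1[OF q] c unfolding W_def tensor_applied_def C1_fun_def
    by (auto simp: matrix_vector_mult_def comp_def intro!: C1_on_diff C1_on_mult C1_on_sum C1_on_const X_C1 tensor_entries_C1[OF q] matrix_inv_metric_C1)
  have "has_bochner_integral ?\<mu> (\<lambda>p. (?n / 2 - 1) * lie_fun A X ?t p) 0"
  proof (rule divergence_theorem[OF assms(2) volume_measure[OF assms(2)] W W_C1])
    show "(\<Sum>i\<in>UNIV. partial c i (\<lambda>p. sqrt (det (g c p)) * W c p $ i) p) = sqrt (det (g c p)) * ((?n / 2 - 1) * lie_fun A X ?t p)"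
      if "c \<in> A" "p \<in> cdom c" for c p
      unfolding W_def using conformal_identity[OF that assms(4,5) assms(6)[OF that]] .
  qed
  then have "has_bochner_integral ?\<mu> (\<lambda>p. (1 / (?n / 2 - 1)) * ((?n / 2 - 1) * lie_fun A X ?t p)) ((1 / (?n / 2 - 1)) * 0)"
    by (rule has_bochner_integral_mult_right)
  moreover have "?n / 2 - 1 \<noteq> 0" using assms(3) by simp
  ultimately show ?thesis by simp
qed

end
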